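(* Let $G \subset \mathrm{Diff}^1_+(\mathbb{S}^2)$ be a group with $\mathrm{M\ddot{o}b}(\mathbb{S}^2) \subsetneq G$. Then the identity component $G_0$ of $G$ is arc $4$-transitive: for every pair of $4$-tuples $(p_1,\dots,p_4)$ and $(q_1,\dots,q_4)$, each consisting of mutually distinct points of $\mathbb{S}^2$, there exists a family $(g_t)_{t\in[0,1]}$ with $g_t \in G$ for all $t$, $g_0=\mathrm{id}$, $t\mapsto g_t$ continuous for the uniform metric $d_\infty(f,g)=\max_{p}d(f(p),g(p))$, and $g_1(p_i)=q_i$ for $i=1,\dots,4$. In particular, $G$ is $4$-transitive.
   Context: $\mathrm{Diff}^1_+(\mathbb{S}^2)$ denotes the group of orientation-preserving $C^1$ diffeomorphisms of the unit sphere $\mathbb{S}^2$. The sphere is identified with $\mathbb{C}\cup\{\infty\}$ by stereographic projection from the North Pole; $\mathrm{M\ddot{o}b}(\mathbb{S}^2)$ is the group of maps $z\mapsto (az+b)/(cz+d)$ with $a,b,c,d\in\mathbb{C}$, $ad-bc=1$ (the conformal orientation-preserving diffeomorphisms of $\mathbb{S}^2$). The identity component $G_0$ is the path component of the identity of $G$ with respect to the uniform topology. A group is $k$-transitive if any $k$-tuple of mutually distinct points can be mapped onto any other such $k$-tuple by a single element of the group. *)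

theory Defs
  imports "HOL-Analysis.Analysis"
begin

definition S2 :: "(real^3) set" where
  "S2 = sphere 0 1"

definition NP :: "real^3" where "NP = vector [0, 0, 1]"
definition SP :: "real^3" where "SP = vector [0, 0, -1]"

text \<open>Stereographic projection from the North pole (the identification with C + infinity)
  and from the South pole (equal to 1/z of the former: holomorphic transition, same orientation).\<close>

definition stereoN :: "real^3 \<Rightarrow> complex" where
  "stereoN x = Complex (x$1) (x$2) / complex_of_real (1 - x$3)"

definition stereoS :: "real^3 \<Rightarrow> complex" where
  "stereoS x = Complex (x$1) (- (x$2)) / complex_of_real (1 + x$3)"

definition stereoN_inv :: "complex \<Rightarrow> real^3" where
  "stereoN_inv z = vector [2 * Re z / ((cmod z)^2 + 1), 2 * Im z / ((cmod z)^2 + 1),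
                           ((cmod z)^2 - 1) / ((cmod z)^2 + 1)]"

definition stereoS_inv :: "complex \<Rightarrow> real^3" where
  "stereoS_inv z = vector [2 * Re z / ((cmod z)^2 + 1), - 2 * Im z / ((cmod z)^2 + 1),
                           (1 - (cmod z)^2) / ((cmod z)^2 + 1)]"

definition chart :: "bool \<Rightarrow> real^3 \<Rightarrow> complex" where
  "chart b = (if b then stereoN else stereoS)"

definition chart_inv :: "bool \<Rightarrow> complex \<Rightarrow> real^3" where
  "chart_inv b = (if b then stereoN_inv else stereoS_inv)"

definition chart_dom :: "bool \<Rightarrow> (real^3) set" where
  "chart_dom b = S2 - {if b then NP else SP}"

definition C1_on :: "complex set \<Rightarrow> (complex \<Rightarrow> complex) \<Rightarrow> bool" where
  "C1_on U h \<longleftrightarrow>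
     (\<exists>h' :: complex \<Rightarrow> complex \<Rightarrow>\<^sub>L complex.
        (\<forall>z\<in>U. (h has_derivative blinfun_apply (h' z)) (at z)) \<and> continuous_on U h')"

definition local_rep :: "(real^3 \<Rightarrow> real^3) \<Rightarrow> bool \<Rightarrow> bool \<Rightarrow> complex \<Rightarrow> complex" where
  "local_rep f i j = chart j \<circ> f \<circ> chart_inv i"

definition local_dom :: "(real^3 \<Rightarrow> real^3) \<Rightarrow> bool \<Rightarrow> bool \<Rightarrow> complex set" where
  "local_dom f i j = chart i ` (chart_dom i \<inter> f -` chart_dom j)"

definition sphere_C1 :: "(real^3 \<Rightarrow> real^3) \<Rightarrow> bool" where
  "sphere_C1 f \<longleftrightarrow> continuous_on S2 f \<and> f ` S2 \<subseteq> S2 \<and>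
     (\<forall>i j. C1_on (local_dom f i j) (local_rep f i j))"

definition jac_det :: "(complex \<Rightarrow> complex) \<Rightarrow> real" where
  "jac_det L = Im (cnj (L 1) * L \<i>)"

definition orientation_preserving :: "(real^3 \<Rightarrow> real^3) \<Rightarrow> bool" where
  "orientation_preserving f \<longleftrightarrow>
     (\<forall>i j. \<forall>z\<in>local_dom f i j. jac_det (frechet_derivative (local_rep f i j) (at z)) > 0)"

definition Diff1_plus :: "(real^3 \<Rightarrow> real^3) set" where
  "Diff1_plus = {f. bij_betw f S2 S2 \<and> (\<forall>x. x \<notin> S2 \<longrightarrow> f x = x) \<and>
                    sphere_C1 f \<and> sphere_C1 (inv f) \<and> orientation_preserving f}"

text \<open>Moebius transformations z |-> (az+b)/(cz+d), transported to S2 via stereoN (NP = infinity).\<close>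

definition mob_sphere :: "complex \<Rightarrow> complex \<Rightarrow> complex \<Rightarrow> complex \<Rightarrow> real^3 \<Rightarrow> real^3" where
  "mob_sphere a b c d p =
     (if p \<notin> S2 then p
      else if p = NP then (if c = 0 then NP else stereoN_inv (a / c))
      else (let z = stereoN p in
            if c * z + d = 0 then NP else stereoN_inv ((a * z + b) / (c * z + d))))"

definition Mob :: "(real^3 \<Rightarrow> real^3) set" where
  "Mob = {mob_sphere a b c d | a b c d. a * d - b * c = 1}"

definition group_of_maps :: "(real^3 \<Rightarrow> real^3) set \<Rightarrow> bool" where
  "group_of_maps G \<longleftrightarrow> id \<in> G \<and> (\<forall>f\<in>G. \<forall>g\<in>G. f \<circ> g \<in> G) \<and> (\<forall>f\<in>G. inv f \<in> G)"

definition uniform_continuous_path :: "(real \<Rightarrow> real^3 \<Rightarrow> real^3) \<Rightarrow> bool" where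
  "uniform_continuous_path g \<longleftrightarrow>
     (\<forall>t\<in>{0..1}. \<forall>e>0. \<exists>\<delta>>0. \<forall>s\<in>{0..1}. \<bar>s - t\<bar> < \<delta> \<longrightarrow>
        (\<forall>p\<in>S2. dist (g s p) (g t p) < e))"

end

theory Submission
  imports Defs "HOL-Complex_Analysis.Cauchy_Integral_Formula"
begin

text \<open>
  Moebius arcs bring every 4-tuple of distinct points to the form \<open>(0, 1, \<infinity>, \<mu>)\<close>, so arc classes of tuples
  correspond to a partition of the connected set of cross ratios \<open>\<mu> \<noteq> 0, 1\<close>, and it suffices that each class
  is open. An element of \<open>G\<close> that is not Moebius yields some \<open>h \<in> G\<close> fixing \<open>0\<close> and \<open>\<infinity>\<close> whose
  derivative \<open>A z = a z + b cnj z\<close> at \<open>0\<close> is not complex linear. All tuples \<open>h (c (h (d x)))\<close> with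
  \<open>c, d\<close> nonzero complex scalars lie in one class. Rescaled at \<open>0\<close>, these maps converge to \<open>A c A d\<close>, which up
  to complex scalars sweep out all \<open>z + k cnj z\<close> with \<open>k\<close> in a disc. The cross ratio of
  \<open>y + k cnj y\<close> is holomorphic in \<open>k\<close> with nonzero derivative at \<open>0\<close> for a suitable tuple \<open>y\<close> of the
  given cross ratio; hence, by Brouwer, the approximating maps also cover a neighbourhood of it.
\<close>

subsection \<open>Stereographic coordinates and Moebius maps\<close>

lemma vector_3_eq_lambda: "vector [a, b, c] = (\<chi> i::3. if i = 1 then a else if i = 2 then b else c)"
  for a b c :: real
  by (simp add: vec_eq_iff forall_3)

lemma continuous_on_vector_3 [continuous_intros]:
  fixes f g h :: "'a::topological_space \<Rightarrow> real"
  assumes "continuous_on S f" "continuous_on S g" "continuous_on S h"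
  shows "continuous_on S (\<lambda>x. vector [f x, g x, h x] :: real^3)"
  unfolding vector_3_eq_lambda
proof (rule continuous_on_vec_lambda)
  fix i :: 3
  show "continuous_on S (\<lambda>x. if i = 1 then f x else if i = 2 then g x else h x)"
    using assms by (cases "i = 1"; cases "i = 2") auto
qed

lemma in_S2_iff: "p \<in> S2 \<longleftrightarrow> (p$1)\<^sup>2 + (p$2)\<^sup>2 + (p$3)\<^sup>2 = 1"
proof -
  have "p \<in> S2 \<longleftrightarrow> (norm p)\<^sup>2 = 1"
    by (simp add: S2_def power2_eq_1_iff) (metis norm_ge_zero le_minus_one_simps(3))
  also have "(norm p)\<^sup>2 = (p$1)\<^sup>2 + (p$2)\<^sup>2 + (p$3)\<^sup>2"
    unfolding power2_norm_eq_inner by (simp add: inner_vec_def sum_3 power2_eq_square)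
  finally show ?thesis .
qed

lemma NP_nth [simp]: "NP$1 = 0" "NP$2 = 0" "NP$3 = 1"
  by (auto simp: NP_def)

lemma SP_nth [simp]: "SP$1 = 0" "SP$2 = 0" "SP$3 = -1"
  by (auto simp: SP_def)

lemma NP_in_S2 [simp]: "NP \<in> S2" and SP_in_S2 [simp]: "SP \<in> S2"
  by (auto simp: in_S2_iff)

lemma eq_NP_iff: "p \<in> S2 \<Longrightarrow> p = NP \<longleftrightarrow> p$3 = 1"
  and eq_SP_iff: "p \<in> S2 \<Longrightarrow> p = SP \<longleftrightarrow> p$3 = -1"
  by (auto simp: in_S2_iff vec_eq_iff forall_3)

lemma stereoN_inv_nth:
  "stereoN_inv z $ 1 = 2 * Re z / ((cmod z)\<^sup>2 + 1)"
  "stereoN_inv z $ 2 = 2 * Im z / ((cmod z)\<^sup>2 + 1)"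
  "stereoN_inv z $ 3 = ((cmod z)\<^sup>2 - 1) / ((cmod z)\<^sup>2 + 1)"
  by (auto simp: stereoN_inv_def)

lemma cmod_sq_plus_1_pos: "(cmod z)\<^sup>2 + 1 > 0"
  by (simp add: add_nonneg_pos)

lemma stereoN_inv_in_S2 [simp]: "stereoN_inv z \<in> S2"
proof -
  have "(2 * Re z)\<^sup>2 + (2 * Im z)\<^sup>2 + ((cmod z)\<^sup>2 - 1)\<^sup>2 = ((cmod z)\<^sup>2 + 1)\<^sup>2"
    unfolding cmod_power2 by algebra
  then show ?thesis
    using cmod_sq_plus_1_pos[of z]
    by (simp add: in_S2_iff stereoN_inv_nth power_divide add_divide_distrib[symmetric])
qed

lemma stereoN_inv_neq_NP [simp]: "stereoN_inv z \<noteq> NP" "NP \<noteq> stereoN_inv z"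
proof -
  have "stereoN_inv z $ 3 \<noteq> 1"
    using cmod_sq_plus_1_pos[of z] by (simp add: stereoN_inv_nth)
  then show "stereoN_inv z \<noteq> NP" "NP \<noteq> stereoN_inv z"
    by auto
qed

lemma stereoN_stereoN_inv [simp]: "stereoN (stereoN_inv z) = z"
proof -
  have "1 - stereoN_inv z $ 3 = 2 / ((cmod z)\<^sup>2 + 1)"
    using cmod_sq_plus_1_pos[of z] by (simp add: stereoN_inv_nth field_simps)
  then show ?thesis
    using cmod_sq_plus_1_pos[of z]
    by (simp add: stereoN_def stereoN_inv_nth complex_eq_iff Re_divide_of_real Im_divide_of_real
             del: of_real_divide)
qed

lemma stereoN_inv_inject [simp]: "stereoN_inv z = stereoN_inv w \<longleftrightarrow> z = w"
  by (metis stereoN_stereoN_inv)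

text \<open>The point of the sphere with homogeneous coordinates \<open>[u : v]\<close>; this turns Moebius maps into
  matrix multiplication and so makes their joint continuity at the pole visible.\<close>

definition homog :: "complex \<Rightarrow> complex \<Rightarrow> real^3" where
  "homog u v = vector [2 * Re (u * cnj v) / ((cmod u)\<^sup>2 + (cmod v)\<^sup>2),
                       2 * Im (u * cnj v) / ((cmod u)\<^sup>2 + (cmod v)\<^sup>2),
                       ((cmod u)\<^sup>2 - (cmod v)\<^sup>2) / ((cmod u)\<^sup>2 + (cmod v)\<^sup>2)]"

lemma homog_0: "u \<noteq> 0 \<Longrightarrow> homog u 0 = NP"
  by (simp add: homog_def NP_def)

lemma homog_eq_stereoN_inv:
  assumes "v \<noteq> 0"
  shows "homog u v = stereoN_inv (u / v)"
proof -
  define z where "z = u / v"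
  have u: "u = z * v" using assms by (simp add: z_def)
  define r where "r = (cmod v)\<^sup>2"
  have r: "r > 0" using assms by (simp add: r_def)
  have uv: "u * cnj v = of_real r * z"
    by (simp add: u r_def complex_norm_square mult_ac del: of_real_power)
  have sq: "(cmod u)\<^sup>2 = r * (cmod z)\<^sup>2"
    by (simp add: u r_def norm_mult power_mult_distrib)
  have s: "(cmod u)\<^sup>2 + (cmod v)\<^sup>2 = r * ((cmod z)\<^sup>2 + 1)" "(cmod u)\<^sup>2 - (cmod v)\<^sup>2 = r * ((cmod z)\<^sup>2 - 1)"
    by (simp_all add: sq r_def algebra_simps)
  show ?thesis
    using r unfolding z_def[symmetric] homog_def stereoN_inv_def uv s by simp
qed

lemma continuous_on_homog:
  assumes "continuous_on S f" "continuous_on S g" "\<And>x. x \<in> S \<Longrightarrow> f x \<noteq> 0 \<or> g x \<noteq> 0"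
  shows "continuous_on S (\<lambda>x. homog (f x) (g x))"
proof -
  have "(cmod (f x))\<^sup>2 + (cmod (g x))\<^sup>2 \<noteq> 0" if "x \<in> S" for x
    using assms(3)[OF that] by (simp add: add_nonneg_eq_0_iff)
  then show ?thesis
    unfolding homog_def using assms by (intro continuous_intros) auto
qed

lemma stereoN_inv_eq_homog: "stereoN_inv z = homog z 1"
  by (simp add: homog_eq_stereoN_inv)

text \<open>Numerator and denominator of the stereographic coordinate are continuous on all of
  space. Used as homogeneous coordinates, they lift the sphere minus one pole; this lift and that of
  \<open>S2_eq_homog_S\<close> cover the sphere.\<close>

lemma S2_eq_homog_N:
  assumes "p \<in> S2" "p \<noteq> NP"
  shows "p = homog (Complex (p$1) (p$2)) (of_real (1 - p$3))"
proof -
  define x y z where "x = p$1" and "y = p$2" and "z = p$3"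
  have z: "z \<noteq> 1" using assms by (simp add: eq_NP_iff z_def)
  have e: "x\<^sup>2 + y\<^sup>2 = (1 - z) * (1 + z)"
    using assms(1) by (simp add: in_S2_iff x_def y_def z_def algebra_simps power2_eq_square)
  have s: "(cmod (Complex x y))\<^sup>2 + (cmod (of_real (1 - z)))\<^sup>2 = 2 * (1 - z)"
    "(cmod (Complex x y))\<^sup>2 - (cmod (of_real (1 - z)))\<^sup>2 = 2 * (1 - z) * z"
    by (simp_all add: cmod_power2 e) algebra+
  have "homog (Complex x y) (of_real (1 - z)) = vector [x, y, z]"
    unfolding homog_def s using z
    by (simp del: right_diff_distrib_numeral)
  then show ?thesis
    by (simp add: x_def y_def z_def vec_eq_iff forall_3)
qed

lemma S2_eq_homog_S:
  assumes "p \<in> S2" "p \<noteq> SP"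
  shows "p = homog (of_real (1 + p$3)) (Complex (p$1) (- (p$2)))"
proof -
  define x y z where "x = p$1" and "y = p$2" and "z = p$3"
  have z: "z \<noteq> -1" using assms by (simp add: eq_SP_iff z_def)
  have e: "x\<^sup>2 + y\<^sup>2 = (1 - z) * (1 + z)"
    using assms(1) by (simp add: in_S2_iff x_def y_def z_def algebra_simps power2_eq_square)
  have s: "(cmod (of_real (1 + z)))\<^sup>2 + (cmod (Complex x (-y)))\<^sup>2 = 2 * (1 + z)"
    "(cmod (of_real (1 + z)))\<^sup>2 - (cmod (Complex x (-y)))\<^sup>2 = 2 * (1 + z) * z"
    by (simp_all add: cmod_power2 e) algebra+
  have "1 + z \<noteq> 0" using z by linarith
  then have "homog (of_real (1 + z)) (Complex x (-y)) = vector [x, y, z]"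
    unfolding homog_def s by (simp del: distrib_left_numeral)
  then show ?thesis
    by (simp add: x_def y_def z_def vec_eq_iff forall_3)
qed

lemma S2_cases [consumes 1, case_names NP finite]:
  assumes "p \<in> S2"
  obtains "p = NP" | z where "p = stereoN_inv z"
proof (cases "p = NP")
  case False
  then have "p$3 \<noteq> 1" using assms by (simp add: eq_NP_iff)
  then have "complex_of_real (1 - p$3) \<noteq> 0"
    by (metis eq_iff_diff_eq_0 of_real_eq_0_iff)
  then show ?thesis
    using S2_eq_homog_N[OF assms False] homog_eq_stereoN_inv that(2) by metis
qed (use that in auto)

lemma stereoN_inv_stereoN: "p \<in> S2 \<Longrightarrow> p \<noteq> NP \<Longrightarrow> stereoN_inv (stereoN p) = p"
  by (cases p rule: S2_cases) auto

section \<open>Moebius maps as matrices of determinant one\<close>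

lemma mob_sphere_stereoN_inv:
  "mob_sphere a b c d (stereoN_inv z) =
     (if c * z + d = 0 then NP else stereoN_inv ((a * z + b) / (c * z + d)))"
  by (simp add: mob_sphere_def)

lemma mob_sphere_NP: "mob_sphere a b c d NP = (if c = 0 then NP else stereoN_inv (a / c))"
  by (simp add: mob_sphere_def)

text \<open>Cramer's rule: the adjugate matrix recovers \<open>u\<close> and \<open>v\<close> from
  the two linear forms.\<close>

lemma det_nonzero:
  fixes a b c d u v :: complex
  assumes "a * d - b * c = 1" "u \<noteq> 0 \<or> v \<noteq> 0"
  shows "a * u + b * v \<noteq> 0 \<or> c * u + d * v \<noteq> 0"
proof (rule ccontr)
  assume "\<not> ?thesis"
  then have *: "a * u + b * v = 0" "c * u + d * v = 0" by auto
  have "u = (a * d - b * c) * u" "v = (a * d - b * c) * v" using assms(1) by auto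
  moreover have "(a * d - b * c) * u = d * (a * u + b * v) - b * (c * u + d * v)"
    "(a * d - b * c) * v = a * (c * u + d * v) - c * (a * u + b * v)" by algebra+
  ultimately show False using assms(2) * by auto
qed

lemma mob_sphere_homog:
  assumes "a * d - b * c = 1" "u \<noteq> 0 \<or> v \<noteq> 0"
  shows "mob_sphere a b c d (homog u v) = homog (a * u + b * v) (c * u + d * v)"
proof (cases "v = 0")
  case True
  then have u: "u \<noteq> 0" using assms by auto
  show ?thesis
  proof (cases "c = 0")
    case True
    then have "a \<noteq> 0" using assms by auto
    then show ?thesis using u \<open>v = 0\<close> True by (simp add: homog_0 mob_sphere_NP)
  next
    case False
    then show ?thesis using u \<open>v = 0\<close> by (simp add: homog_0 mob_sphere_NP homog_eq_stereoN_inv)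
  qed
next
  case False
  have e: "c * (u / v) + d = (c * u + d * v) / v" "a * (u / v) + b = (a * u + b * v) / v"
    using False by (simp_all add: field_simps)
  show ?thesis
  proof (cases "c * u + d * v = 0")
    case True
    then have "a * u + b * v \<noteq> 0" using det_nonzero[OF assms] by blast
    then show ?thesis using True False
      unfolding homog_eq_stereoN_inv[OF False] mob_sphere_stereoN_inv e by (simp add: homog_0)
  next
    case nz: False
    then show ?thesis using False
      unfolding homog_eq_stereoN_inv[OF False] homog_eq_stereoN_inv[OF nz] mob_sphere_stereoN_inv e
      by simp
  qed
qed

lemma S2_homog_cases:
  assumes "p \<in> S2" obtains u v where "u \<noteq> 0 \<or> v \<noteq> 0" "p = homog u v"
  using assms
proof (cases p rule: S2_cases)
  case NP
  then show ?thesis using that[of 1 0] by (simp add: homog_0)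
next
  case (finite z)
  then show ?thesis using that[of z 1] by (simp add: stereoN_inv_eq_homog)
qed

lemma mob_sphere_comp:
  assumes "a * d - b * c = 1" "a' * d' - b' * c' = 1"
  shows "mob_sphere a b c d \<circ> mob_sphere a' b' c' d' =
    mob_sphere (a * a' + b * c') (a * b' + b * d') (c * a' + d * c') (c * b' + d * d')"
proof
  fix p
  have det: "(a * a' + b * c') * (c * b' + d * d') - (a * b' + b * d') * (c * a' + d * c') = 1"
  proof -
    have "(a * a' + b * c') * (c * b' + d * d') - (a * b' + b * d') * (c * a' + d * c')
      = (a * d - b * c) * (a' * d' - b' * c')" by algebra
    then show ?thesis using assms by simp
  qed
  show "(mob_sphere a b c d \<circ> mob_sphere a' b' c' d') p =
    mob_sphere (a * a' + b * c') (a * b' + b * d') (c * a' + d * c') (c * b' + d * d') p"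
  proof (cases "p \<in> S2")
    case True
    then obtain u v where uv: "u \<noteq> 0 \<or> v \<noteq> 0" "p = homog u v" using S2_homog_cases by blast
    then show ?thesis
      using det_nonzero[OF assms(2) uv(1)]
      unfolding uv(2) mob_sphere_homog[OF det uv(1)]
      by (simp add: mob_sphere_homog[OF assms(1)] mob_sphere_homog[OF assms(2)])
        (simp add: algebra_simps)
  qed (simp add: mob_sphere_def)
qed

lemma mob_sphere_id: "mob_sphere 1 0 0 1 = id"
proof
  fix p show "mob_sphere 1 0 0 1 p = id p"
  proof (cases "p \<in> S2")
    case True
    then show ?thesis
      by (cases p rule: S2_cases) (simp_all add: mob_sphere_NP mob_sphere_stereoN_inv)
  qed (simp add: mob_sphere_def)
qed

lemma MobI: "a * d - b * c = 1 \<Longrightarrow> mob_sphere a b c d \<in> Mob"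
  by (auto simp: Mob_def)

lemma Mob_comp: "f \<in> Mob \<Longrightarrow> g \<in> Mob \<Longrightarrow> f \<circ> g \<in> Mob"
proof -
  assume "f \<in> Mob" "g \<in> Mob"
  then obtain a b c d a' b' c' d' where
    *: "f = mob_sphere a b c d" "a * d - b * c = 1" "g = mob_sphere a' b' c' d'" "a' * d' - b' * c' = 1"
    by (auto simp: Mob_def)
  have "(a * a' + b * c') * (c * b' + d * d') - (a * b' + b * d') * (c * a' + d * c')
      = (a * d - b * c) * (a' * d' - b' * c')" by algebra
  then show ?thesis
    unfolding *(1,3) mob_sphere_comp[OF *(2,4)] using * by (intro MobI) simp
qed

text \<open>Since the determinant is one, the adjugate matrix is the inverse.\<close>

lemma Mob_inverse:
  assumes "f \<in> Mob" obtains g where "g \<in> Mob" "g \<circ> f = id" "f \<circ> g = id"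
proof -
  obtain a b c d where *: "f = mob_sphere a b c d" and det: "a * d - b * c = 1"
    using assms by (auto simp: Mob_def)
  have det': "d * a - (- b) * (- c) = 1" using det by (simp add: mult.commute)
  have "mob_sphere d (-b) (-c) a \<circ> f = id" "f \<circ> mob_sphere d (-b) (-c) a = id"
    unfolding * mob_sphere_comp[OF det' det] mob_sphere_comp[OF det det'] mob_sphere_id[symmetric]
    using det by (simp_all add: mult.commute)
  then show ?thesis using that MobI[OF det'] by blast
qed


text \<open>Away from either pole a point lifts continuously to homogeneous coordinates, on which
  the matrix acts polynomially. The two patches are relatively open, so continuity on each
  suffices.\<close>

lemma continuous_on_mob_sphere:
  fixes a b c d :: "real \<Rightarrow> complex"
  assumes "continuous_on I a" "continuous_on I b" "continuous_on I c" "continuous_on I d"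
    and det: "\<And>t. t \<in> I \<Longrightarrow> a t * d t - b t * c t = 1"
  shows "continuous_on (I \<times> S2) (\<lambda>(t, p). mob_sphere (a t) (b t) (c t) (d t) p)"
proof -
  note cont = assms(1-4)[THEN continuous_on_compose2, OF continuous_on_fst[OF continuous_on_id]]
  have patch: "continuous_on (I \<times> (S2 - {Q})) (\<lambda>(t, p). mob_sphere (a t) (b t) (c t) (d t) p)"
    if U: "continuous_on UNIV U" and V: "continuous_on UNIV V"
      and nz: "\<And>p. p \<in> S2 - {Q} \<Longrightarrow> U p \<noteq> 0 \<or> V p \<noteq> 0"
      and p: "\<And>p. p \<in> S2 - {Q} \<Longrightarrow> p = homog (U p) (V p)"
    for Q and U V :: "real^3 \<Rightarrow> complex"
  proof -
    let ?D = "I \<times> (S2 - {Q})"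
    have [continuous_intros]: "continuous_on ?D (\<lambda>x. U (snd x))" "continuous_on ?D (\<lambda>x. V (snd x))"
      by (auto intro!: continuous_on_compose2[OF U] continuous_on_compose2[OF V] continuous_intros)
    have "continuous_on ?D (\<lambda>x. homog (a (fst x) * U (snd x) + b (fst x) * V (snd x))
       (c (fst x) * U (snd x) + d (fst x) * V (snd x)))"
      by (intro continuous_on_homog continuous_intros cont det_nonzero nz det) auto
    moreover have "(case x of (t, p) \<Rightarrow> mob_sphere (a t) (b t) (c t) (d t) p) =
       homog (a (fst x) * U (snd x) + b (fst x) * V (snd x))
       (c (fst x) * U (snd x) + d (fst x) * V (snd x))" if "x \<in> ?D" for x
      using that nz[of "snd x"] p[of "snd x"] det[of "fst x"] mob_sphere_homog
      by (auto split: prod.splits) (metis mob_sphere_homog)+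
    ultimately show ?thesis
      using continuous_on_cong by (metis (mono_tags, lifting))
  qed
  have "continuous_on (I \<times> (S2 - {NP})) (\<lambda>(t, p). mob_sphere (a t) (b t) (c t) (d t) p)"
  proof (rule patch)
    show "continuous_on UNIV (\<lambda>p::real^3. Complex (p$1) (p$2))"
      by (intro continuous_intros)
    show "continuous_on UNIV (\<lambda>p::real^3. complex_of_real (1 - p$3))"
      by (intro continuous_intros)
    show "Complex (p$1) (p$2) \<noteq> 0 \<or> complex_of_real (1 - p$3) \<noteq> 0" if "p \<in> S2 - {NP}" for p
      using that eq_NP_iff[of p] by auto
  qed (use S2_eq_homog_N in blast)
  note N = this
  have S: "continuous_on (I \<times> (S2 - {SP})) (\<lambda>(t, p). mob_sphere (a t) (b t) (c t) (d t) p)"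
  proof (rule patch)
    show "continuous_on UNIV (\<lambda>p::real^3. complex_of_real (1 + p$3))"
      by (intro continuous_intros)
    show "continuous_on UNIV (\<lambda>p::real^3. Complex (p$1) (- (p$2)))"
      by (intro continuous_intros)
    show "complex_of_real (1 + p$3) \<noteq> 0 \<or> Complex (p$1) (- (p$2)) \<noteq> 0" if "p \<in> S2 - {SP}" for p
      using that eq_SP_iff[of p] by (metis DiffE add_eq_0_iff insertI1 of_real_eq_0_iff)
  qed (use S2_eq_homog_S in blast)
  have D: "I \<times> S2 = I \<times> (S2 - {NP}) \<union> I \<times> (S2 - {SP})"
    by (auto simp: vec_eq_iff forall_3)
  have O: "openin (top_of_set (I \<times> S2)) (I \<times> (S2 - {Q}))" for Q
  proof -
    have "I \<times> (S2 - {Q}) = (I \<times> S2) \<inter> (UNIV \<times> - {Q})" by auto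
    moreover have "open ((UNIV :: real set) \<times> (- {Q}))" by (intro open_Times) auto
    ultimately show ?thesis by (metis openin_open_Int)
  qed
  show ?thesis
    unfolding D
    by (intro continuous_on_Un_local_open N S) (unfold D[symmetric], rule O, rule O)
qed

subsection \<open>Arcs of tuples\<close>

lemma compact_S2: "compact S2"
  by (simp add: S2_def)

text \<open>On the compact set \<open>{0..1} \<times> S2\<close> joint continuity is uniform, which
  gives one \<open>\<delta>\<close> for all points of the sphere.\<close>

lemma uniform_continuous_pathI:
  assumes "continuous_on ({0..1} \<times> S2) (\<lambda>(t, p). \<gamma> t p)"
  shows "uniform_continuous_path \<gamma>"
  unfolding uniform_continuous_path_def
proof (intro ballI allI impI)
  fix t e :: real assume t: "t \<in> {0..1}" and e: "e > 0"
  have "uniformly_continuous_on ({0..1} \<times> S2) (\<lambda>(t, p). \<gamma> t p)"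
    by (intro compact_uniformly_continuous assms compact_Times compact_S2 compact_Icc)
  then obtain \<delta> where \<delta>: "\<delta> > 0" "\<And>x x'. x \<in> {0..1} \<times> S2 \<Longrightarrow> x' \<in> {0..1} \<times> S2 \<Longrightarrow> dist x' x < \<delta>
      \<Longrightarrow> dist (case x' of (t, p) \<Rightarrow> \<gamma> t p) (case x of (t, p) \<Rightarrow> \<gamma> t p) < e"
    using e unfolding uniformly_continuous_on_def by metis
  have "dist (\<gamma> s p) (\<gamma> t p) < e" if "s \<in> {0..1}" "\<bar>s - t\<bar> < \<delta>" "p \<in> S2" for s p
    using \<delta>(2)[of "(t, p)" "(s, p)"] that t by (simp add: dist_Pair_Pair dist_real_def)
  then show "\<exists>\<delta>>0. \<forall>s\<in>{0..1}. \<bar>s - t\<bar> < \<delta> \<longrightarrow> (\<forall>p\<in>S2. dist (\<gamma> s p) (\<gamma> t p) < e)"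
    using \<delta>(1) by blast
qed

text \<open>Joint continuity replaces continuity in the uniform metric because it passes directly to
  pointwise composites of arcs.\<close>

definition arc_in :: "(real^3 \<Rightarrow> real^3) set \<Rightarrow> (real \<Rightarrow> real^3 \<Rightarrow> real^3) \<Rightarrow> bool" where
  "arc_in G \<gamma> \<longleftrightarrow> (\<forall>t\<in>{0..1}. \<gamma> t \<in> G) \<and> continuous_on ({0..1} \<times> S2) (\<lambda>(t, p). \<gamma> t p)"

definition arc_related :: "(real^3 \<Rightarrow> real^3) set \<Rightarrow> (nat \<Rightarrow> real^3) \<Rightarrow> (nat \<Rightarrow> real^3) \<Rightarrow> bool" where
  "arc_related G x y \<longleftrightarrow> (\<exists>\<gamma>. arc_in G \<gamma> \<and> \<gamma> 0 = id \<and> (\<forall>i<4. \<gamma> 1 (x i) = y i))"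

definition normal_tuple :: "complex \<Rightarrow> nat \<Rightarrow> real^3" where
  "normal_tuple \<mu> = (\<lambda>i. if i = 0 then stereoN_inv 0 else if i = 1 then stereoN_inv 1
     else if i = 2 then NP else stereoN_inv \<mu>)"

text \<open>Normalised so that it tends to \<mu> at (0, 1, y, \<mu>) as y goes to infinity, in
  agreement with \<open>normal_tuple\<close>.\<close>

definition cross_ratio :: "(nat \<Rightarrow> complex) \<Rightarrow> complex" where
  "cross_ratio y = (y 3 - y 0) * (y 1 - y 2) / ((y 3 - y 2) * (y 1 - y 0))"

lemma all_less_4: "(\<forall>i<4::nat. P i) \<longleftrightarrow> P 0 \<and> P 1 \<and> P 2 \<and> P 3"
  by (simp add: numeral_eq_Suc All_less_Suc) auto

lemma inj_on_4: "inj_on y {..<4::nat} \<longleftrightarrow>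
    y 0 \<noteq> y 1 \<and> y 0 \<noteq> y 2 \<and> y 0 \<noteq> y 3 \<and> y 1 \<noteq> y 2 \<and> y 1 \<noteq> y 3 \<and> y 2 \<noteq> y 3"
proof -
  have "{..<4::nat} = {0, 1, 2, 3}" by auto
  then show ?thesis by (simp add: inj_on_insert insert_Diff_if) blast
qed

section \<open>One-parameter families of Moebius maps\<close>

definition transl :: "complex \<Rightarrow> real^3 \<Rightarrow> real^3" where
  "transl b = mob_sphere 1 b 0 1"

text \<open>The logarithmic parameter lets any two dilations be joined by a segment.\<close>

definition dilat :: "complex \<Rightarrow> real^3 \<Rightarrow> real^3" where
  "dilat w = mob_sphere (exp (w / 2)) 0 0 (exp (- w / 2))"

text \<open>A path from the identity to z -> -1/z, reached at \<open>pi / 2\<close>, which exchanges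
  0 and infinity.\<close>

definition rot :: "real \<Rightarrow> real^3 \<Rightarrow> real^3" where
  "rot t = mob_sphere (of_real (cos t)) (- of_real (sin t)) (of_real (sin t)) (of_real (cos t))"

lemma transl_simps [simp]: "transl b NP = NP" "transl b (stereoN_inv z) = stereoN_inv (z + b)"
  by (simp_all add: transl_def mob_sphere_NP mob_sphere_stereoN_inv)

lemma dilat_simps [simp]: "dilat w NP = NP" "dilat w (stereoN_inv z) = stereoN_inv (exp w * z)"
proof -
  have "exp (w / 2) * z / exp (- (w / 2)) = exp w * z"
    by (simp add: exp_minus field_simps exp_add[symmetric])
  then show "dilat w NP = NP" "dilat w (stereoN_inv z) = stereoN_inv (exp w * z)"
    by (simp_all add: dilat_def mob_sphere_NP mob_sphere_stereoN_inv)
qed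

lemma rot_half_pi [simp]: "rot (pi / 2) NP = stereoN_inv 0"
   "rot (pi / 2) (stereoN_inv 0) = NP"
   "z \<noteq> 0 \<Longrightarrow> rot (pi / 2) (stereoN_inv z) = stereoN_inv (- 1 / z)"
  by (simp_all add: rot_def mob_sphere_NP mob_sphere_stereoN_inv)

lemma rot_0: "rot 0 = id" and transl_0: "transl 0 = id" and dilat_0: "dilat 0 = id"
  by (simp_all add: rot_def transl_def dilat_def mob_sphere_id)

lemma rot_det: "complex_of_real (cos t) * of_real (cos t) - - of_real (sin t) * of_real (sin t) = 1"
  using sin_cos_squared_add3[of t] by (simp flip: of_real_mult of_real_add)

lemma transl_Mob: "transl b \<in> Mob" and dilat_Mob: "dilat w \<in> Mob" and rot_Mob: "rot t \<in> Mob"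
proof -
  show "rot t \<in> Mob"
    unfolding rot_def by (rule MobI[OF rot_det])
qed (auto simp: transl_def dilat_def exp_add[symmetric] intro!: MobI)

section \<open>Arcs in a group containing the Moebius maps\<close>

locale Mob_overgroup =
  fixes G :: "(real^3 \<Rightarrow> real^3) set"
  assumes group: "group_of_maps G" and diffeos: "G \<subseteq> Diff1_plus" and Mob_subset: "Mob \<subseteq> G"
begin

lemma comp_in: "f \<in> G \<Longrightarrow> g \<in> G \<Longrightarrow> f \<circ> g \<in> G"
  using group by (auto simp: group_of_maps_def)

lemma inv_in: "f \<in> G \<Longrightarrow> inv f \<in> G"
  using group by (auto simp: group_of_maps_def)

lemma continuous_on_S2: "f \<in> G \<Longrightarrow> continuous_on S2 f"
  using diffeos by (auto simp: Diff1_plus_def sphere_C1_def)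

lemma image_S2: "f \<in> G \<Longrightarrow> f ` S2 = S2"
  using diffeos by (auto simp: Diff1_plus_def bij_betw_def)

lemma in_S2: "f \<in> G \<Longrightarrow> p \<in> S2 \<Longrightarrow> f p \<in> S2"
  using image_S2 by blast

text \<open>Elements are the identity off the sphere, hence bijective on the whole space, so that
  \<open>inv\<close> is a genuine inverse.\<close>

lemma bij: assumes "f \<in> G" shows "bij f"
proof -
  have f: "bij_betw f S2 S2" "\<And>x. x \<notin> S2 \<Longrightarrow> f x = x"
    using assms diffeos by (auto simp: Diff1_plus_def)
  then have "bij_betw f (- S2) (- S2)"
    by (intro bij_betw_byWitness[where f' = id]) auto
  with f(1) have "bij_betw f (S2 \<union> - S2) (S2 \<union> - S2)"
    by (intro bij_betw_combine) auto
  then show ?thesis by simp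
qed

lemma inv_comp: "f \<in> G \<Longrightarrow> inv f \<circ> f = id" "f \<in> G \<Longrightarrow> f \<circ> inv f = id"
  using bij by (simp_all add: bij_is_inj surj_iff[symmetric] bij_is_surj)

lemma Mob_in: "transl b \<in> G" "dilat w \<in> G" "rot t \<in> G"
  using Mob_subset transl_Mob dilat_Mob rot_Mob by auto

lemma arc_in_const: assumes "f \<in> G" shows "arc_in G (\<lambda>_. f)"
proof -
  have "continuous_on ({0..1::real} \<times> S2) (\<lambda>x. f (snd x))"
    by (rule continuous_on_compose2[OF continuous_on_S2[OF assms] continuous_on_snd[OF continuous_on_id]]) auto
  then show ?thesis using assms by (simp add: arc_in_def split_def)
qed

lemma arc_in_comp:
  assumes "arc_in G \<gamma>" "arc_in G \<delta>"
  shows "arc_in G (\<lambda>t. \<gamma> t \<circ> \<delta> t)"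
proof -
  have "continuous_on ({0..1} \<times> S2) (\<lambda>x. (fst x, \<delta> (fst x) (snd x)))"
    using assms(2) by (auto simp: arc_in_def split_def intro!: continuous_intros)
  moreover have "(\<lambda>x. (fst x, \<delta> (fst x) (snd x))) ` ({0..1} \<times> S2) \<subseteq> {0..1} \<times> S2"
    using assms(2) in_S2 by (auto simp: arc_in_def)
  ultimately have "continuous_on ({0..1} \<times> S2) (\<lambda>x. case (fst x, \<delta> (fst x) (snd x)) of (t, p) \<Rightarrow> \<gamma> t p)"
    using assms(1) unfolding arc_in_def
    by (elim conjE) (rule continuous_on_compose2[of "{0..1} \<times> S2" "\<lambda>(t, p). \<gamma> t p"])
  then show ?thesis using assms comp_in by (simp add: arc_in_def split_def)
qed

lemma arc_in_mob:
  assumes "continuous_on {0..1} a" "continuous_on {0..1} b" "continuous_on {0..1} c" "continuous_on {0..1} d"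
    and "\<And>t. t \<in> {0..1} \<Longrightarrow> a t * d t - b t * c t = 1"
  shows "arc_in G (\<lambda>t. mob_sphere (a t) (b t) (c t) (d t))"
  using continuous_on_mob_sphere[OF assms] assms(5) Mob_subset MobI unfolding arc_in_def by blast

lemma arc_in_transl: "arc_in G (\<lambda>t. transl (of_real t * b))"
  unfolding transl_def by (intro arc_in_mob continuous_intros) auto

lemma arc_in_dilat:
  "continuous_on {0..1} w \<Longrightarrow> arc_in G (\<lambda>t. dilat (w t))"
  unfolding dilat_def by (intro arc_in_mob continuous_intros) (auto simp: exp_add[symmetric])

lemma arc_in_rot: "arc_in G (\<lambda>t. rot (t * s))"
  unfolding rot_def by (intro arc_in_mob continuous_intros rot_det)

text \<open>Composing with \<open>inv (\<gamma> 0)\<close> on the right makes any arc start at the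
  identity, so arcs with an arbitrary starting element may be used.\<close>

lemma arc_relatedI:
  assumes \<gamma>: "arc_in G \<gamma>" and "\<And>i. i < 4 \<Longrightarrow> \<gamma> 0 (z i) = x i" "\<And>i. i < 4 \<Longrightarrow> \<gamma> 1 (z i) = y i"
  shows "arc_related G x y"
proof -
  have 0: "\<gamma> 0 \<in> G" using \<gamma> by (simp add: arc_in_def)
  have "arc_in G (\<lambda>t. \<gamma> t \<circ> inv (\<gamma> 0))"
    by (intro arc_in_comp \<gamma> arc_in_const inv_in 0)
  moreover have "\<gamma> 1 (inv (\<gamma> 0) (x i)) = y i" if "i < 4" for i
    using assms(2,3)[OF that] bij[OF 0] by (metis bij_inv_eq_iff)
  ultimately show ?thesis
    unfolding arc_related_def using inv_comp[OF 0] by (intro exI[of _ "\<lambda>t. \<gamma> t \<circ> inv (\<gamma> 0)"]) auto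
qed

lemma arc_related_refl: "arc_related G x x"
  using group by (intro arc_relatedI[OF arc_in_const[of id]]) (auto simp: group_of_maps_def)

lemma arc_related_sym:
  assumes "arc_related G x y" shows "arc_related G y x"
proof -
  obtain \<gamma> where \<gamma>: "arc_in G \<gamma>" "\<gamma> 0 = id" "\<And>i. i < 4 \<Longrightarrow> \<gamma> 1 (x i) = y i"
    using assms by (auto simp: arc_related_def)
  have "continuous_on ({0..1} \<times> S2) (\<lambda>x. case (1 - fst x, snd x) of (t, p) \<Rightarrow> \<gamma> t p)"
  proof (rule continuous_on_compose2[of "{0..1} \<times> S2" "\<lambda>(t, p). \<gamma> t p"])
    show "continuous_on ({0..1} \<times> S2) (\<lambda>(t, p). \<gamma> t p)" using \<gamma>(1) by (simp add: arc_in_def)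
    show "continuous_on ({0..1::real} \<times> S2) (\<lambda>x. (1 - fst x, snd x))" by (intro continuous_intros)
  qed auto
  then have "arc_in G (\<lambda>t. \<gamma> (1 - t))"
    using \<gamma>(1) by (auto simp: arc_in_def split_def)
  then show ?thesis
    using \<gamma> by (intro arc_relatedI[where \<gamma> = "\<lambda>t. \<gamma> (1 - t)" and z = x]) auto
qed

text \<open>The pointwise product of the two arcs serves; no concatenation of paths is
  needed.\<close>

lemma arc_related_trans:
  assumes "arc_related G x y" "arc_related G y z" shows "arc_related G x z"
proof -
  obtain \<gamma> \<delta> where *: "arc_in G \<gamma>" "\<gamma> 0 = id" "\<And>i. i < 4 \<Longrightarrow> \<gamma> 1 (x i) = y i"
    "arc_in G \<delta>" "\<delta> 0 = id" "\<And>i. i < 4 \<Longrightarrow> \<delta> 1 (y i) = z i"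
    using assms by (auto simp: arc_related_def)
  then show ?thesis
    unfolding arc_related_def using arc_in_comp[OF *(4,1)]
    by (intro exI[of _ "\<lambda>t. \<delta> t \<circ> \<gamma> t"]) auto
qed

lemma arc_related_transl: "arc_related G x (\<lambda>i. transl b (x i))"
  by (rule arc_relatedI[OF arc_in_transl[of b], of x]) (simp_all add: transl_0)

lemma arc_related_dilat: "arc_related G x (\<lambda>i. dilat w (x i))"
proof -
  have "arc_in G (\<lambda>t. dilat (of_real t * w))" by (intro arc_in_dilat continuous_intros)
  then show ?thesis by (rule arc_relatedI[of _ x]) (simp_all add: dilat_0)
qed

lemma arc_related_rot: "arc_related G x (\<lambda>i. rot s (x i))"
  by (rule arc_relatedI[OF arc_in_rot[of s], of x]) (simp_all add: rot_0)

section \<open>Normal forms of 4-tuples\<close>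

lemma arc_related_normal_tuple_NP:
  assumes "x 0 = stereoN_inv a" "x 1 = stereoN_inv b" "x 2 = NP" "x 3 = stereoN_inv c" "a \<noteq> b"
  shows "arc_related G x (normal_tuple ((c - a) / (b - a)))"
proof -
  \<comment> \<open>\<open>dilat w\<close> multiplies by 1/(b - a); after translation by -a this is
    the affine map taking a, b to 0, 1.\<close>
  define w where "w = Ln (1 / (b - a))"
  have w: "exp w = 1 / (b - a)" using assms by (simp add: w_def)
  have "arc_related G x (\<lambda>i. dilat w (transl (- a) (x i)))"
    by (rule arc_related_trans[OF arc_related_transl arc_related_dilat])
  then show ?thesis
    unfolding arc_related_def all_less_4 using assms
    by (simp add: normal_tuple_def w)
qed

text \<open>The map z -> -1/(z - y 2) sends \<open>y 2\<close> to infinity. Normalising the other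
  points affinely then leaves the cross ratio as parameter.\<close>

lemma arc_related_normal_tuple_finite:
  assumes "inj_on y {..<4}"
  shows "arc_related G (\<lambda>i. stereoN_inv (y i)) (normal_tuple (cross_ratio y))"
proof -
  note ne = assms[unfolded inj_on_4]
  define x where "x = (\<lambda>i. rot (pi / 2) (transl (- y 2) (stereoN_inv (y i))))"
  have 1: "arc_related G (\<lambda>i. stereoN_inv (y i)) x"
    unfolding x_def by (rule arc_related_trans[OF arc_related_transl arc_related_rot])
  have "arc_related G x (normal_tuple ((-1 / (y 3 - y 2) - (-1 / (y 0 - y 2))) /
      (-1 / (y 1 - y 2) - (-1 / (y 0 - y 2)))))"
    using ne by (intro arc_related_normal_tuple_NP) (auto simp: x_def)
  moreover have "(-1 / (y 3 - y 2) - (-1 / (y 0 - y 2))) / (-1 / (y 1 - y 2) - (-1 / (y 0 - y 2)))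
     = cross_ratio y"
  proof -
    have nz: "y 3 - y 2 \<noteq> 0" "y 0 - y 2 \<noteq> 0" "y 1 - y 2 \<noteq> 0" "y 1 - y 0 \<noteq> 0" using ne by auto
    have "-1 / (y 3 - y 2) - (-1 / (y 0 - y 2)) = (y 3 - y 0) / ((y 3 - y 2) * (y 0 - y 2))"
      "-1 / (y 1 - y 2) - (-1 / (y 0 - y 2)) = (y 1 - y 0) / ((y 1 - y 2) * (y 0 - y 2))"
      using nz by (simp_all add: divide_simps)
    then show ?thesis using nz by (simp add: cross_ratio_def)
  qed
  ultimately show ?thesis using 1 arc_related_trans by metis
qed

lemma arc_related_normal_tuple:
  assumes "\<forall>i<4. p i \<in> S2" "inj_on p {..<4}"
  obtains \<mu> where "\<mu> \<noteq> 0" "\<mu> \<noteq> 1" "arc_related G p (normal_tuple \<mu>)"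
proof -
  note result = that
  have *: thesis if x: "arc_related G p x" "\<forall>i<4. x i \<in> S2" "inj_on x {..<4}" "x 2 = NP" for x
  proof -
    have "\<exists>z. x i = stereoN_inv z" if "i \<in> {0, 1, 3}" for i
    proof -
      have "x i \<in> S2" "x i \<noteq> NP" using x that by (auto simp: inj_on_4 all_less_4)
      then show ?thesis by (cases "x i" rule: S2_cases) auto
    qed
    then obtain a b c where abc: "x 0 = stereoN_inv a" "x 1 = stereoN_inv b" "x 3 = stereoN_inv c"
      by fastforce
    then have "a \<noteq> b" "c \<noteq> a" "c \<noteq> b" using x(3) by (auto simp: inj_on_4)
    then show thesis
      by (intro result[of "(c - a) / (b - a)"]
            arc_related_trans[OF x(1) arc_related_normal_tuple_NP[OF abc(1,2) x(4) abc(3)]]) auto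
  qed
  show thesis
  proof (cases "p 2 = NP")
    case True
    then show ?thesis using *[OF arc_related_refl] assms by simp
  next
    case False
    then obtain z where z: "p 2 = stereoN_inv z" using assms S2_cases[of "p 2" thesis] by (auto simp: all_less_4)
    define x where "x = (\<lambda>i. rot (pi / 2) (transl (- z) (p i)))"
    show ?thesis
    proof (rule *)
      show "arc_related G p x"
        unfolding x_def by (rule arc_related_trans[OF arc_related_transl arc_related_rot])
      show "\<forall>i<4. x i \<in> S2" using assms in_S2 Mob_in by (auto simp: x_def)
      show "inj_on x {..<4}"
        using assms(2) unfolding x_def inj_on_4 inj_eq[OF bij[OF Mob_in(3), THEN bij_is_inj]]
          inj_eq[OF bij[OF Mob_in(1), THEN bij_is_inj]] .
      show "x 2 = NP" by (simp add: x_def z)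
    qed
  qed
qed

end

subsection \<open>A non-conformal element\<close>

text \<open>The map in the affine coordinate. It is faithful on the whole plane when
  \<open>h\<close> is an element of \<open>G\<close> fixing \<open>NP\<close>, see
  \<open>rep_works\<close>.\<close>

definition rep :: "(real^3 \<Rightarrow> real^3) \<Rightarrow> complex \<Rightarrow> complex" where
  "rep h z = stereoN (h (stereoN_inv z))"

text \<open>\<open>a\<close> and \<open>b\<close> are the Wirtinger coefficients of
  \<open>D\<close>.\<close>

lemma real_linear_complex_decomp:
  assumes "bounded_linear D"
  obtains a b where "D = (\<lambda>z. a * z + b * cnj z)" "jac_det D = (cmod a)\<^sup>2 - (cmod b)\<^sup>2"
proof -
  interpret bounded_linear D by fact
  define a b where "a = (D 1 - \<i> * D \<i>) / 2" and "b = (D 1 + \<i> * D \<i>) / 2"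
  have D1: "D 1 = a + b" and Di: "D \<i> = \<i> * (a - b)"
    by (simp_all add: a_def b_def field_simps)
  have "D z = a * z + b * cnj z" for z
  proof -
    have "D z = D (Re z *\<^sub>R 1 + Im z *\<^sub>R \<i>)"
      by (metis complex_eq mult.commute of_real_def scaleR_conv_of_real)
    also have "\<dots> = of_real (Re z) * (a + b) + of_real (Im z) * (\<i> * (a - b))"
      unfolding add scaleR D1 Di by (simp add: scaleR_conv_of_real)
    also have "\<dots> = a * z + b * cnj z"
      by (simp add: complex_eq_iff algebra_simps)
    finally show ?thesis .
  qed
  moreover have "jac_det D = (cmod a)\<^sup>2 - (cmod b)\<^sup>2"
    unfolding jac_det_def D1 Di cmod_power2 by (simp add: algebra_simps power2_eq_square)
  ultimately show ?thesis using that by blast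
qed

context Mob_overgroup
begin

lemma rep_works:
  assumes "h \<in> G" "h NP = NP"
  shows "h (stereoN_inv z) = stereoN_inv (rep h z)"
proof -
  have "h (stereoN_inv z) \<noteq> NP"
    using bij[OF assms(1), THEN bij_is_inj] assms(2) by (metis injD stereoN_inv_neq_NP(1))
  then show ?thesis
    using in_S2[OF assms(1)] by (simp add: rep_def stereoN_inv_stereoN)
qed

lemma rep_eq_iff:
  assumes "h \<in> G" "h NP = NP"
  shows "rep h z = rep h w \<longleftrightarrow> z = w"
  using rep_works[OF assms] bij[OF assms(1), THEN bij_is_inj] by (metis injD stereoN_inv_inject)

text \<open>Injectivity and \<open>h NP = NP\<close> put every finite point into the local domain of
  the north chart. There, positivity of the Jacobian says exactly that |b| < |a|.\<close>

lemma rep_has_derivative: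
  assumes "h \<in> G" "h NP = NP"
  obtains a b where "(rep h has_derivative (\<lambda>z. a * z + b * cnj z)) (at z0)" "cmod b < cmod a"
proof -
  have rep: "local_rep h True True = rep h"
    by (auto simp: local_rep_def chart_def chart_inv_def rep_def)
  have C1: "C1_on (local_dom h True True) (rep h)" and
    op: "\<forall>z\<in>local_dom h True True. jac_det (frechet_derivative (rep h) (at z)) > 0"
    using assms(1) diffeos unfolding rep[symmetric]
    by (auto simp: Diff1_plus_def sphere_C1_def orientation_preserving_def)
  have "stereoN_inv z0 \<in> chart_dom True \<inter> h -` chart_dom True"
    using rep_works[OF assms] by (simp add: chart_dom_def)
  then have z0: "z0 \<in> local_dom h True True"
    unfolding local_dom_def chart_def by (auto intro!: image_eqI[of _ _ "stereoN_inv z0"])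
  obtain D where D: "(rep h has_derivative D) (at z0)"
    using C1 z0 unfolding C1_on_def by blast
  obtain a b where ab: "D = (\<lambda>z. a * z + b * cnj z)" "jac_det D = (cmod a)\<^sup>2 - (cmod b)\<^sup>2"
    using real_linear_complex_decomp has_derivative_bounded_linear[OF D] by blast
  have "jac_det D > 0" using op z0 frechet_derivative_at[OF D] by auto
  then have "cmod b < cmod a"
    using ab(2) by (metis diff_gt_0_iff_gt norm_ge_zero power2_less_imp_less)
  then show ?thesis using that D ab(1) by blast
qed

text \<open>Conjugating by translations shows that \<open>h\<close> is conformal everywhere, hence entire; conjugating by
  \<open>z \<mapsto> - 1 / z\<close> shows that it grows linearly, so Liouville applies.\<close>

lemma conformal_imp_Mob:
  assumes h: "h \<in> G" "h NP = NP" "h (stereoN_inv 0) = stereoN_inv 0"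
    and conf: "\<And>g a b. g \<in> G \<Longrightarrow> g NP = NP \<Longrightarrow> g (stereoN_inv 0) = stereoN_inv 0 \<Longrightarrow>
        (rep g has_derivative (\<lambda>z. a * z + b * cnj z)) (at 0) \<Longrightarrow> cmod b < cmod a \<Longrightarrow> b = 0"
  shows "h \<in> Mob"
proof -
  define \<phi> where "\<phi> = rep h"
  have \<phi>0: "\<phi> 0 = 0" using h by (simp add: \<phi>_def rep_def)
  have \<phi>_nz: "\<phi> z = 0 \<longleftrightarrow> z = 0" for z
    using rep_eq_iff[OF h(1,2), of z 0] \<phi>0 by (simp add: \<phi>_def)
  have hz: "h (stereoN_inv z) = stereoN_inv (\<phi> z)" for z
    using rep_works[OF h(1,2)] by (simp add: \<phi>_def)
  have diff: "\<exists>a. a \<noteq> 0 \<and> (\<phi> has_field_derivative a) (at z0)" for z0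
  proof -
    obtain a b where ab: "(\<phi> has_derivative (\<lambda>z. a * z + b * cnj z)) (at z0)" "cmod b < cmod a"
      using rep_has_derivative[OF h(1,2)] unfolding \<phi>_def by blast
    \<comment> \<open>The derivative of \<open>\<phi>\<close> at \<open>z0\<close> becomes the
      derivative of \<open>g\<close> at 0, where \<open>conf\<close> applies.\<close>
    define g where "g = transl (- \<phi> z0) \<circ> h \<circ> transl z0"
    have g: "g \<in> G" "g NP = NP" "g (stereoN_inv 0) = stereoN_inv 0"
      unfolding g_def using comp_in Mob_in h by (auto simp: hz)
    have rg: "rep g = (\<lambda>z. \<phi> (z + z0) - \<phi> z0)"
      by (auto simp: rep_def g_def hz)
    have shift: "((\<lambda>z. z + z0) has_derivative (\<lambda>z. z)) (at 0)"
      by (auto intro!: derivative_eq_intros)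
    have "(\<phi> has_derivative (\<lambda>z. a * z + b * cnj z)) (at (0 + z0))"
      using ab(1) by simp
    from has_derivative_diff[OF has_derivative_compose[OF shift this] has_derivative_const]
    have "(rep g has_derivative (\<lambda>z. a * z + b * cnj z)) (at 0)"
      unfolding rg by simp
    then have "b = 0" using conf[OF g _ ab(2)] by simp
    then have "(\<phi> has_field_derivative a) (at z0)" "a \<noteq> 0"
      using ab by (auto simp: has_field_derivative_def)
    then show ?thesis by blast
  qed
  \<comment> \<open>The behaviour of \<open>h\<close> at infinity is read off from \<open>g\<close>
    at 0.\<close>
  define g where "g = rot (pi / 2) \<circ> h \<circ> rot (pi / 2)"
  have g: "g \<in> G" "g NP = NP" "g (stereoN_inv 0) = stereoN_inv 0"
    unfolding g_def using comp_in Mob_in h by auto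
  have rg: "rep g z = - 1 / \<phi> (- 1 / z)" if "z \<noteq> 0" for z
    using that by (simp add: rep_def g_def hz \<phi>_nz)
  have rg0: "rep g 0 = 0" using g by (simp add: rep_def)
  obtain a b where ab: "(rep g has_derivative (\<lambda>z. a * z + b * cnj z)) (at 0)" "cmod b < cmod a"
    using rep_has_derivative[OF g(1,2)] by blast
  then have "b = 0" using conf[OF g] by blast
  then have a: "a \<noteq> 0" "(rep g has_field_derivative a) (at 0)"
    using ab by (auto simp: has_field_derivative_def)
  then have "(\<lambda>z. rep g z / z) \<midarrow>0\<rightarrow> a"
    by (simp add: DERIV_def rg0)
  then obtain \<delta> where \<delta>: "\<delta> > 0" "\<And>z. z \<noteq> 0 \<Longrightarrow> cmod z < \<delta> \<Longrightarrow> cmod (rep g z / z - a) < cmod a / 2"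
    using a(1) unfolding LIM_eq by (metis diff_zero half_gt_zero zero_less_norm_iff)
  \<comment> \<open>Near 0 the quotient of \<open>rep g z\<close> by z has modulus at least |a|/2;
    substituting -1/z turns this into an upper bound for \<open>\<phi>\<close>.\<close>
  have growth: "cmod (\<phi> z) \<le> (2 / cmod a) * cmod z ^ 1" if "2 / \<delta> \<le> cmod z" for z
  proof -
    have "cmod z > 0" using that \<delta>(1) by (smt (verit) divide_pos_pos)
    then have z: "z \<noteq> 0" by auto
    have "cmod (- 1 / z) < \<delta>"
      using that \<delta>(1) \<open>cmod z > 0\<close> by (simp add: norm_divide field_simps)
    then have "cmod (rep g (- 1 / z) / (- 1 / z) - a) < cmod a / 2"
      using z by (intro \<delta>(2)) auto
    then have "cmod (z / \<phi> z - a) < cmod a / 2"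
      using z rg[of "- 1 / z"] by simp
    then have "cmod a / 2 \<le> cmod (z / \<phi> z)"
      using norm_triangle_ineq2[of a "a - z / \<phi> z"] by (simp add: norm_minus_commute)
    then show ?thesis
      using a z \<phi>_nz[of z] by (simp add: norm_divide field_simps)
  qed
  have hol: "\<phi> holomorphic_on UNIV"
    using diff unfolding holomorphic_on_def field_differentiable_def by auto
  obtain \<alpha> where \<alpha>: "\<alpha> \<noteq> 0" "(\<phi> has_field_derivative \<alpha>) (at 0)" using diff by blast
  \<comment> \<open>Growth of degree one leaves only the Taylor terms of order 0 and 1, and the
    constant one is \<open>\<phi> 0 = 0\<close>.\<close>
  have lin: "\<phi> z = \<alpha> * z" for z
    using Liouville_polynomial[OF hol growth, where \<xi> = z] DERIV_imp_deriv[OF \<alpha>(2)] \<phi>0 by simp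
  have "h = dilat (Ln \<alpha>)"
  proof
    fix p
    show "h p = dilat (Ln \<alpha>) p"
    proof (cases "p \<in> S2")
      case True
      then show ?thesis
        by (cases p rule: S2_cases) (use \<alpha> h in \<open>simp_all add: hz lin\<close>)
    next
      case False
      then show ?thesis using h(1) diffeos by (auto simp: dilat_def mob_sphere_def Diff1_plus_def)
    qed
  qed
  then show ?thesis using dilat_Mob by simp
qed

text \<open>Composing \<open>f\<close> with Moebius maps brings the images of infinity and 0 back to
  infinity and 0. The result is still not Moebius, so \<open>conformal_imp_Mob\<close> must fail in
  its hypothesis \<open>conf\<close>.\<close>

lemma exists_nonconformal:
  assumes "f \<in> G" "f \<notin> Mob"
  obtains h a b where "h \<in> G" "h NP = NP" "h (stereoN_inv 0) = stereoN_inv 0"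
    "(rep h has_derivative (\<lambda>z. a * z + b * cnj z)) (at 0)" "b \<noteq> 0" "cmod b < cmod a"
proof -
  have "f NP \<in> S2" using in_S2 assms by simp
  then obtain m where m: "m \<in> Mob" "m (f NP) = NP"
  proof (cases "f NP" rule: S2_cases)
    case NP
    then show ?thesis using that[of "transl 0"] transl_Mob transl_simps(1)[of 0] by metis
  next
    case (finite z)
    then show ?thesis
      using that[of "rot (pi / 2) \<circ> transl (- z)"] transl_Mob rot_Mob Mob_comp by simp
  qed
  then have mf: "m \<circ> f \<in> G" using Mob_subset comp_in assms by blast
  define m' where "m' = transl (- rep (m \<circ> f) 0) \<circ> m"
  have m': "m' \<in> Mob" using m transl_Mob Mob_comp by (simp add: m'_def)
  define h where "h = m' \<circ> f"
  have h: "h \<in> G" "h NP = NP" "h (stereoN_inv 0) = stereoN_inv 0"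
    using rep_works[OF mf, of 0] m m' Mob_subset comp_in assms by (auto simp: h_def m'_def)
  have "h \<notin> Mob"
  proof
    assume "h \<in> Mob"
    obtain g where g: "g \<in> Mob" "g \<circ> m' = id" using Mob_inverse[OF m'] by blast
    then have "g \<circ> h = f" unfolding h_def o_assoc by simp
    then show False using \<open>h \<in> Mob\<close> g Mob_comp assms by metis
  qed
  then show thesis using conformal_imp_Mob[OF h] that by metis
qed

end

subsection \<open>Stretching the cross ratio\<close>

text \<open>Solutions of \<open>f k = w\<close> are the fixed points of the Newton-type map k -> k +
  (w - f k)/D. The error of \<open>f\<close> and the distance from \<open>w\<close> to \<mu>
  contribute at most r/2 each, so it maps the disc to itself and Brouwer applies.\<close>

lemma disc_image_covers_ball:
  fixes f :: "complex \<Rightarrow> complex"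
  assumes cont: "continuous_on (cball 0 r) f" and r: "r > 0" and "D \<noteq> 0"
    and approx: "\<And>k. k \<in> cball 0 r \<Longrightarrow> cmod (f k - (\<mu> + D * k)) \<le> cmod D * r / 2"
    and w: "w \<in> cball \<mu> (cmod D * r / 2)"
  obtains k where "k \<in> cball 0 r" "f k = w"
proof -
  define g where "g k = k + (w - f k) / D" for k
  have "continuous_on (cball 0 r) g"
    unfolding g_def using \<open>D \<noteq> 0\<close> by (intro continuous_intros cont) auto
  moreover have "g ` cball 0 r \<subseteq> cball 0 r"
  proof clarify
    fix k assume k: "k \<in> cball (0::complex) r"
    have "g k = ((w - \<mu>) - (f k - (\<mu> + D * k))) / D"
      using \<open>D \<noteq> 0\<close> by (simp add: g_def field_simps)
    then have "cmod (g k) * cmod D = cmod ((w - \<mu>) - (f k - (\<mu> + D * k)))"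
      using \<open>D \<noteq> 0\<close> by (simp add: norm_divide)
    also have "\<dots> \<le> cmod D * r / 2 + cmod D * r / 2"
    proof (rule order_trans[OF norm_triangle_ineq4 add_mono])
      show "cmod (w - \<mu>) \<le> cmod D * r / 2" using w by (simp add: dist_norm norm_minus_commute)
    qed (rule approx[OF k])
    finally show "g k \<in> cball 0 r" using \<open>D \<noteq> 0\<close> by (simp add: mult.commute)
  qed
  ultimately obtain k where "k \<in> cball 0 r" "g k = k"
    using brouwer[of "cball (0::complex) r" g] r by (auto simp: image_subset_iff_funcset)
  then show ?thesis using that \<open>D \<noteq> 0\<close> by (simp add: g_def)
qed

text \<open>Up to complex factors, \<open>A \<circ> c \<circ> A \<circ> d\<close> is \<open>z \<mapsto> z + K cnj z\<close> where \<open>\<bar>K\<bar>\<close> is governed by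
  \<open>arg c\<close> and \<open>arg K\<close> by \<open>arg d\<close>. The parameter \<open>k\<close> is centred at \<open>K = b / a\<close> rather than at
  \<open>K = 0\<close>, where these polar coordinates degenerate; the factor \<open>y - b / a * cnj y\<close> undoes that shift.\<close>

lemma beltrami_factorization:
  fixes a b :: complex
  assumes "b \<noteq> 0" "cmod b < cmod a" and A: "A = (\<lambda>z. a * z + b * cnj z)"
  obtains r c d M where "r > 0" "continuous_on (cball 0 r) c" "continuous_on (cball 0 r) d"
    "\<And>k. k \<in> cball 0 r \<Longrightarrow> c k \<noteq> 0 \<and> d k \<noteq> 0 \<and> M k \<noteq> 0"
    "\<And>k y. k \<in> cball 0 r \<Longrightarrow>
       A (c k * A (d k * (y - b / a * cnj y))) = M k * (y + k * cnj y)"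
proof -
  have a: "a \<noteq> 0" using assms by auto
  define \<kappa> where "\<kappa> = b / a"
  have b: "b = a * \<kappa>" using a by (simp add: \<kappa>_def)
  define \<rho> where "\<rho> = (cmod \<kappa>)\<^sup>2"
  have \<kappa>: "\<kappa> \<noteq> 0" using assms a by (simp add: \<kappa>_def)
  have "cmod \<kappa> < 1" using assms a by (simp add: \<kappa>_def norm_divide)
  then have \<rho>: "0 < \<rho>" "\<rho> < 1" using \<kappa> by (auto simp: \<rho>_def power_less_one_iff)
  have \<kappa>\<kappa>: "\<kappa> * cnj \<kappa> = of_real \<rho>" unfolding \<rho>_def complex_norm_square ..
  \<comment> \<open>A disc automorphism with \<open>K 0 = \<kappa>\<close>: for x = y - \<kappa> cnj
    y, the vectors x + K cnj x and y + k cnj y agree up to a complex factor.\<close>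
  define K where "K k = (k + \<kappa>) / (1 + k * cnj \<kappa>)" for k
  \<comment> \<open>With C = a c, the word has Beltrami coefficient \<kappa> (C + cnj C) cnj d / ((C
    + \<rho> cnj C) d). Setting Re C = 1 and q = C + \<rho> cnj C, this equals K when cnj d / d = u
    with u = K q / (2 \<kappa>). \<open>R\<close> is the squared imaginary part of q that makes |u|
    = 1.\<close>
  define R where "R k = 4 * \<rho> / (cmod (K k))\<^sup>2 - (1 + \<rho>)\<^sup>2" for k
  define q where "q k = Complex (1 + \<rho>) (sqrt (R k))" for k
  define u where "u k = K k * q k / (2 * \<kappa>)" for k
  define c where "c k = Complex 1 (sqrt (R k) / (1 - \<rho>)) / a" for k
  \<comment> \<open>As |u| = 1, the number 1 + cnj u satisfies cnj d = u d.\<close>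
  define d where "d k = 1 + cnj (u k)" for k
  define M where "M k = a * q k * d k * (of_real (1 - \<rho>) / (1 + k * cnj \<kappa>))" for k
  \<comment> \<open>Open conditions under which the formulas make sense; the last one gives Re d >
    0, hence d is nonzero.\<close>
  define good where "good = {k. 1 + k * cnj \<kappa> \<noteq> 0 \<and> K k \<noteq> 0 \<and> R k > 0 \<and> Re (u k) > -1}"
  have "\<forall>\<^sub>F k in nhds 0. k \<in> good"
  proof -
    have K0: "K 0 = \<kappa>" by (simp add: K_def)
    \<comment> \<open>\<open>R 0\<close> is 4 - (1 + \<rho>)^2, positive because |b| < |a| gives
      \<rho> < 1.\<close>
    have R0: "R 0 > 0"
    proof -
      have "(1 + \<rho>)\<^sup>2 < 2\<^sup>2" using \<rho> by (intro power_strict_mono) auto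
      then show ?thesis using \<rho> \<kappa> by (simp add: R_def K0 \<rho>_def)
    qed
    have u0: "Re (u 0) > -1" using \<kappa> \<rho> by (simp add: u_def K0 q_def)
    have tK: "isCont K 0" unfolding K_def by (intro continuous_intros) auto
    have tR: "isCont R 0" unfolding R_def using \<kappa> K0 by (intro continuous_intros tK) auto
    have "isCont u 0"
      unfolding u_def q_def Complex_eq using \<kappa> by (intro continuous_intros tK tR) auto
    then have tu: "isCont (\<lambda>k. Re (u k)) 0"
      by (rule bounded_linear.isCont[OF bounded_linear_Re])
    have e: "\<forall>\<^sub>F k in nhds 0. f k \<in> S" if "isCont f 0" "open S" "f 0 \<in> S"
      for f :: "complex \<Rightarrow> 'a::topological_space" and S
      using topological_tendstoD[OF that(1)[unfolded isCont_def] that(2,3)] that(3)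
      by (simp add: eventually_nhds_conv_at)
    have "\<forall>\<^sub>F k in nhds 0. 1 + k * cnj \<kappa> \<in> - {0}"
      by (rule e) (auto intro!: continuous_intros)
    moreover have "\<forall>\<^sub>F k in nhds 0. K k \<in> - {0}"
      using K0 \<kappa> by (intro e tK) auto
    moreover have "\<forall>\<^sub>F k in nhds 0. R k \<in> {0<..}"
      using R0 by (intro e tR) auto
    moreover have "\<forall>\<^sub>F k in nhds 0. Re (u k) \<in> {-1<..}"
      using u0 by (intro e tu) auto
    ultimately show ?thesis
      by eventually_elim (auto simp: good_def)
  qed
  then obtain r where r: "r > 0" "cball 0 r \<subseteq> good"
    unfolding eventually_nhds_metric_le by (auto simp: subset_iff dist_commute)
  have cK: "continuous_on good K" unfolding K_def by (intro continuous_intros) (auto simp: good_def)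
  have cR: "continuous_on good R" unfolding R_def by (intro continuous_intros cK) (auto simp: good_def)
  have cc: "continuous_on good c" unfolding c_def Complex_eq using a \<rho> by (intro continuous_intros cR) auto
  have cd: "continuous_on good d" unfolding d_def u_def q_def Complex_eq using \<kappa> by (intro continuous_intros cK cR) auto
  show thesis
  proof (rule that[OF r(1) continuous_on_subset[OF cc r(2)] continuous_on_subset[OF cd r(2)]])
    fix k assume "k \<in> cball (0::complex) r"
    then have k: "1 + k * cnj \<kappa> \<noteq> 0" "K k \<noteq> 0" "R k > 0" "Re (u k) > -1"
      using r(2) by (auto simp: good_def)
    have "Re (d k) \<noteq> 0" using k(4) by (simp add: d_def)
    then have d: "d k \<noteq> 0" by auto
    have "Re (a * c k) \<noteq> 0" using a by (simp add: c_def)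
    then have c: "c k \<noteq> 0" by auto
    have "Re (q k) \<noteq> 0" using \<rho> by (simp add: q_def)
    then have q: "q k \<noteq> 0" by auto
    have "M k \<noteq> 0" using a q d \<rho> k(1) by (simp add: M_def flip: of_real_diff)
    with c d show "c k \<noteq> 0 \<and> d k \<noteq> 0 \<and> M k \<noteq> 0" by blast
    fix y
    have "(cmod (q k))\<^sup>2 = 4 * \<rho> / (cmod (K k))\<^sup>2"
      using k(3) by (simp add: q_def cmod_power2 R_def)
    then have "(cmod (u k))\<^sup>2 = 1"
      using k(2) \<kappa> by (simp add: u_def norm_mult norm_divide power_mult_distrib power_divide \<rho>_def)
    then have uu: "u k * cnj (u k) = 1" by (metis complex_norm_square of_real_1)
    have du: "cnj (d k) = u k * d k" using uu by (simp add: d_def algebra_simps)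
    have Kq: "K k * q k = 2 * \<kappa> * u k" using \<kappa> by (simp add: u_def)
    define C where "C = a * c k"
    have C: "C = Complex 1 (sqrt (R k) / (1 - \<rho>))" using a by (simp add: C_def c_def)
    have C1: "C + cnj C = 2" by (simp add: C complex_eq_iff)
    have C2: "C + of_real \<rho> * cnj C = q k"
    proof -
      have "sqrt (R k) / (1 - \<rho>) - \<rho> * (sqrt (R k) / (1 - \<rho>)) = (1 - \<rho>) * (sqrt (R k) / (1 - \<rho>))"
        by (simp only: left_diff_distrib mult_1)
      also have "\<dots> = sqrt (R k)" using \<rho> by simp
      finally show ?thesis by (simp add: C q_def complex_eq_iff)
    qed
    define x where "x = y - \<kappa> * cnj y"
    have "a * (c k * (a * (d k * x) + b * cnj (d k * x))) + b * cnj (c k * (a * (d k * x) + b * cnj (d k * x)))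
      = a * ((C + (\<kappa> * cnj \<kappa>) * cnj C) * d k * x + \<kappa> * (C + cnj C) * cnj (d k) * cnj x)"
      by (simp add: b C_def algebra_simps)
    also have "\<dots> = a * (q k * d k * x + \<kappa> * 2 * (u k * d k) * cnj x)"
      unfolding \<kappa>\<kappa> C1 C2 du by simp
    also have "\<dots> = a * (q k * d k * x + (K k * q k) * d k * cnj x)"
      unfolding Kq by (simp add: algebra_simps)
    also have "\<dots> = a * q k * d k * (x + K k * cnj x)" by (simp add: algebra_simps)
    also have "x + K k * cnj x = of_real (1 - \<rho>) / (1 + k * cnj \<kappa>) * (y + k * cnj y)"
    proof -
      have "(x + K k * cnj x) * (1 + k * cnj \<kappa>) = x * (1 + k * cnj \<kappa>) + (k + \<kappa>) * cnj x"
        using k(1) by (simp add: K_def field_simps)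
      also have "\<dots> = (1 - \<kappa> * cnj \<kappa>) * (y + k * cnj y)"
        by (simp add: x_def algebra_simps)
      finally show ?thesis unfolding \<kappa>\<kappa> using k(1) by (simp add: field_simps)
    qed
    finally show "A (c k * A (d k * (y - b / a * cnj y))) = M k * (y + k * cnj y)"
      unfolding A \<kappa>_def[symmetric] x_def[symmetric] M_def by (simp only: mult.assoc)
  qed
qed

lemma cross_ratio_scale:
  assumes "m \<noteq> 0" shows "cross_ratio (\<lambda>j. m * y j) = cross_ratio y"
  using assms by (simp add: cross_ratio_def flip: right_diff_distrib)

text \<open>Logarithmic differentiation: each difference p becomes p + k cnj p, whose logarithmic
  derivative at 0 is cnj p / p.\<close>

lemma cross_ratio_stretch_derivative:
  assumes "inj_on y {..<4}"
  shows "((\<lambda>k. cross_ratio (\<lambda>j. y j + k * cnj (y j))) has_field_derivative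
    cross_ratio y * (cnj (y 3 - y 0) / (y 3 - y 0) + cnj (y 1 - y 2) / (y 1 - y 2)
       - cnj (y 3 - y 2) / (y 3 - y 2) - cnj (y 1 - y 0) / (y 1 - y 0))) (at 0)"
proof -
  define p q r s where "p = y 3 - y 0" and "q = y 1 - y 2" and "r = y 3 - y 2" and "s = y 1 - y 0"
  have nz: "p \<noteq> 0" "q \<noteq> 0" "r \<noteq> 0" "s \<noteq> 0"
    using assms by (auto simp: inj_on_4 p_def q_def r_def s_def)
  have "((\<lambda>k. (p + k * cnj p) * (q + k * cnj q) / ((r + k * cnj r) * (s + k * cnj s))) has_field_derivative
    p * q / (r * s) * (cnj p / p + cnj q / q - cnj r / r - cnj s / s)) (at 0)"
    using nz by (auto intro!: derivative_eq_intros simp: divide_simps) (simp add: algebra_simps)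
  then show ?thesis
    by (simp add: cross_ratio_def p_def q_def r_def s_def algebra_simps)
qed

text \<open>The derivative vanishes at every tuple on a real line, so for real \<open>\<mu>\<close> the points are taken on the unit
  circle, as the Cayley images of \<open>0, 1, \<infinity>, \<mu>\<close>.\<close>

lemma exists_stretchable_tuple:
  assumes "\<mu> \<noteq> 0" "\<mu> \<noteq> 1"
  obtains y D where "inj_on y {..<4}" "cross_ratio y = \<mu>" "D \<noteq> 0"
    "((\<lambda>k. cross_ratio (\<lambda>j. y j + k * cnj (y j))) has_field_derivative D) (at 0)"
proof -
  note result = that
  have *: thesis if y: "inj_on y {..<4}" "cross_ratio y = \<mu>"
    "cnj (y 3 - y 0) / (y 3 - y 0) + cnj (y 1 - y 2) / (y 1 - y 2)
       - cnj (y 3 - y 2) / (y 3 - y 2) - cnj (y 1 - y 0) / (y 1 - y 0) \<noteq> 0" for y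
    by (rule result[OF y(1,2) _ cross_ratio_stretch_derivative[OF y(1)]]) (use y assms(1) in simp)
  show thesis
  proof (cases "cnj \<mu> = \<mu>")
    case False
    \<comment> \<open>\<nu> solves \<nu>/(1 - \<nu>) = \<mu>, the cross ratio equation for (0, 1/2,
      1, \<nu>). The terms from the real differences cancel, and the other two differ because \<nu>
      is not real.\<close>
    define \<nu> where "\<nu> = \<mu> / (1 + \<mu>)"
    define y :: "nat \<Rightarrow> complex" where "y = (\<lambda>j. if j = 0 then 0 else if j = 1 then 1/2 else if j = 2 then 1 else \<nu>)"
    have m: "1 + \<mu> \<noteq> 0" using False by (metis add_eq_0_iff complex_cnj_minus complex_cnj_one)
    have \<mu>: "\<mu> = \<nu> / (1 - \<nu>)" using m by (simp add: \<nu>_def divide_simps)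
    then have \<nu>: "cnj \<nu> \<noteq> \<nu>" using False by (metis complex_cnj_diff complex_cnj_divide complex_cnj_one)
    then have "\<nu> \<noteq> of_real x" for x by auto
    from this[of 0] this[of 1] this[of "1 / 2"] have nz: "\<nu> \<noteq> 0" "\<nu> \<noteq> 1" "\<nu> \<noteq> 1 / 2" by simp_all
    have "cnj \<nu> / \<nu> \<noteq> cnj (\<nu> - 1) / (\<nu> - 1)" using \<nu> nz by (simp add: divide_simps algebra_simps)
    moreover have "cross_ratio y = \<mu>"
      unfolding \<mu> using nz by (simp add: cross_ratio_def y_def) (simp add: divide_simps algebra_simps)
    ultimately show ?thesis
      using nz by (intro *[of y]) (auto simp: y_def inj_on_4)
  next
    case True
    define \<nu> where "\<nu> = (\<mu> - \<i>) / (\<mu> + \<i>)"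
    define y :: "nat \<Rightarrow> complex" where "y = (\<lambda>j. if j = 0 then - 1 else if j = 1 then - \<i> else if j = 2 then 1 else \<nu>)"
    have nz: "\<mu> + \<i> \<noteq> 0" "\<mu> - \<i> \<noteq> 0"
      using True by (auto simp: complex_eq_iff)
    have d: "\<nu> + 1 = 2 * \<mu> / (\<mu> + \<i>)" "\<nu> - 1 = - 2 * \<i> / (\<mu> + \<i>)"
      using nz by (simp_all add: \<nu>_def field_simps)
    have nu: "\<nu> \<noteq> - 1" "\<nu> \<noteq> 1" using d nz assms by (auto simp: add_eq_0_iff)
    have nu3: "\<nu> \<noteq> - \<i>"
    proof
      assume "\<nu> = - \<i>"
      then have "\<mu> - \<i> = - \<i> * (\<mu> + \<i>)" using nz by (simp add: \<nu>_def field_simps)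
      then have "(\<mu> - 1) * (1 + \<i>) = 0" by (simp add: algebra_simps)
      then show False using assms by (simp add: complex_eq_iff)
    qed
    have t: "cnj (\<nu> + 1) / (\<nu> + 1) = (\<mu> + \<i>) / (\<mu> - \<i>)"
        "cnj (\<nu> - 1) / (\<nu> - 1) = - (\<mu> + \<i>) / (\<mu> - \<i>)"
      unfolding d using nz True assms by (simp_all add: divide_simps) (simp add: algebra_simps)
    \<comment> \<open>The derivative bracket will turn out to be twice the difference of these two
      sides; equality would force \<mu> = 1.\<close>
    have neq: "(\<mu> + \<i>) / (\<mu> - \<i>) \<noteq> \<i>"
    proof
      assume "(\<mu> + \<i>) / (\<mu> - \<i>) = \<i>"
      then have "\<mu> + \<i> = \<i> * (\<mu> - \<i>)" using nz by (simp add: field_simps)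
      then have "(\<mu> - 1) * (1 - \<i>) = 0" by (simp add: algebra_simps)
      then show False using assms by (simp add: complex_eq_iff)
    qed
    have cr: "cross_ratio y = \<mu>"
    proof -
      have "cross_ratio y = (\<nu> + 1) * (- \<i> - 1) / ((\<nu> - 1) * (1 - \<i>))"
        by (simp add: cross_ratio_def y_def)
      also have "\<dots> = \<mu> * ((- \<i> - 1) / (- \<i> * (1 - \<i>)))"
        unfolding d using nz by (simp add: divide_simps)
      also have "(- \<i> - 1) / (- \<i> * (1 - \<i>)) = 1"
        by (subst divide_eq_1_iff) (simp add: complex_eq_iff)
      finally show ?thesis by simp
    qed
    have s: "cnj (- \<i> - 1) / (- \<i> - 1) = - \<i>" "cnj (- \<i> + 1) / (- \<i> + 1) = \<i>"
      by (simp_all add: complex_eq_iff Re_divide Im_divide)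
    have y: "y 0 = - 1" "y 1 = - \<i>" "y 2 = 1" "y 3 = \<nu>" by (simp_all add: y_def)
    show ?thesis
    proof (rule *[OF _ cr])
      show "inj_on y {..<4}"
        unfolding inj_on_4 y using nu nu3 by (auto simp: complex_eq_iff)
      have "cnj (y 3 - y 0) / (y 3 - y 0) + cnj (y 1 - y 2) / (y 1 - y 2)
          - cnj (y 3 - y 2) / (y 3 - y 2) - cnj (y 1 - y 0) / (y 1 - y 0)
        = (\<mu> + \<i>) / (\<mu> - \<i>) + - \<i> - - (\<mu> + \<i>) / (\<mu> - \<i>) - \<i>"
        unfolding y diff_minus_eq_add t s ..
      also have "\<dots> = 2 * ((\<mu> + \<i>) / (\<mu> - \<i>) - \<i>)"
        unfolding minus_divide_left[symmetric] by simp
      also have "\<dots> \<noteq> 0" using neq unfolding mult_eq_0_iff right_minus_eq by simp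
      finally show "cnj (y 3 - y 0) / (y 3 - y 0) + cnj (y 1 - y 2) / (y 1 - y 2)
          - cnj (y 3 - y 2) / (y 3 - y 2) - cnj (y 1 - y 0) / (y 1 - y 0) \<noteq> 0" .
    qed
  qed
qed

subsection \<open>Orbits are open\<close>

text \<open>Write \<phi> z = A z + |z| \<rho> z with \<rho> continuous and \<rho> 0 = 0. Then
  \<phi>(e z)/e = A z + |z| \<rho>(e z) for e > 0, and the right side is jointly continuous up to e
  = 0.\<close>

lemma blowup_continuous_extension:
  fixes \<phi> A :: "complex \<Rightarrow> complex"
  assumes cont: "\<And>z. isCont \<phi> z" and "\<phi> 0 = 0" and A: "(\<phi> has_derivative A) (at 0)"
  obtains \<Phi> :: "real \<Rightarrow> complex \<Rightarrow> complex"
  where "continuous_on UNIV (\<lambda>(e, z). \<Phi> e z)" "\<And>z. \<Phi> 0 z = A z"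
    "\<And>e z. e > 0 \<Longrightarrow> \<Phi> e z = \<phi> (of_real e * z) / of_real e"
proof -
  interpret A: bounded_linear A using A by (rule has_derivative_bounded_linear)
  \<comment> \<open>\<open>\<rho> 0 = 0\<close> because \<open>inverse 0 = 0\<close>\<close>
  define \<rho> where "\<rho> z = (\<phi> z - A z) /\<^sub>R cmod z" for z
  have \<rho>: "\<phi> z = A z + cmod z *\<^sub>R \<rho> z" for z
    using \<open>\<phi> 0 = 0\<close> by (cases "z = 0") (auto simp: \<rho>_def A.zero)
  have cA: "isCont A z" for z by (rule A.isCont) simp
  have "isCont \<rho> z" for z
  proof (cases "z = 0")
    case True
    have "((\<lambda>y. (\<phi> y - \<phi> 0 - A (y - 0)) /\<^sub>R norm (y - 0)) \<longlongrightarrow> 0) (at 0)"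
      using A unfolding has_derivative_def by (simp add: has_derivative_at_within netlimit_at)
    then show ?thesis
      unfolding isCont_def True using \<open>\<phi> 0 = 0\<close> by (simp add: \<rho>_def[abs_def] A.zero)
  next
    case False
    then show ?thesis unfolding \<rho>_def by (intro continuous_intros cont cA) auto
  qed
  then have c\<rho>: "continuous_on UNIV \<rho>" by (simp add: continuous_at_imp_continuous_on)
  have cA': "continuous_on UNIV A" using cA by (simp add: continuous_at_imp_continuous_on)
  define \<Phi> where "\<Phi> e z = A z + cmod z *\<^sub>R \<rho> (of_real e * z)" for e z
  show thesis
  proof (rule that[of \<Phi>])
    have 1: "continuous_on UNIV (\<lambda>x::real \<times> complex. A (snd x))"
      by (rule continuous_on_compose2[OF cA']) (auto intro: continuous_intros)
    have 2: "continuous_on UNIV (\<lambda>x::real \<times> complex. \<rho> (of_real (fst x) * snd x))"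
      by (rule continuous_on_compose2[OF c\<rho>]) (auto intro!: continuous_intros)
    show "continuous_on UNIV (\<lambda>(e, z). \<Phi> e z)"
      unfolding \<Phi>_def split_def by (intro continuous_intros 1 2)
    show "\<Phi> 0 z = A z" for z by (simp add: \<Phi>_def \<rho>_def A.zero \<open>\<phi> 0 = 0\<close>)
    show "\<Phi> e z = \<phi> (of_real e * z) / of_real e" if "e > 0" for e z
    proof -
      have "A (of_real e * z) = e *\<^sub>R A z" using A.scaleR by (simp add: scaleR_conv_of_real)
      then show ?thesis
        unfolding \<Phi>_def \<rho>[of "of_real e * z"] using that
        by (simp add: norm_mult scaleR_conv_of_real field_simps)
    qed
  qed
qed

text \<open>A nonzero kernel vector of the real linear map would give |a| = |b|.\<close>

lemma stretch_inj:
  assumes "cmod b < cmod a" "a * z + b * cnj z = a * w + b * cnj w"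
  shows "z = w"
proof (rule ccontr)
  assume "z \<noteq> w"
  have "a * (z - w) = - (b * cnj (z - w))" using assms(2) by (simp add: algebra_simps)
  then have "cmod a * cmod (z - w) = cmod b * cmod (z - w)"
    by (metis complex_mod_cnj norm_minus_cancel norm_mult)
  then show False using assms(1) \<open>z \<noteq> w\<close> by simp
qed

context Mob_overgroup
begin

text \<open>The logarithms of the two dilations are interpolated linearly while \<open>h\<close>
  stays fixed.\<close>

lemma arc_related_dilat_word:
  assumes "h \<in> G"
  shows "arc_related G (\<lambda>i. h (dilat v (h (dilat w (x i))))) (\<lambda>i. h (dilat v' (h (dilat w' (x i)))))"
proof -
  define \<gamma> where "\<gamma> t = h \<circ> dilat (of_real (1 - t) * v + of_real t * v') \<circ>
     (h \<circ> dilat (of_real (1 - t) * w + of_real t * w'))" for t :: real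
  have "arc_in G \<gamma>"
    unfolding \<gamma>_def by (intro arc_in_comp arc_in_const assms arc_in_dilat continuous_intros)
  then show ?thesis by (rule arc_relatedI[where z = x]) (simp_all add: \<gamma>_def)
qed

text \<open>The limiting cross ratio \<open>H 0\<close> has derivative \<open>D\<close> at k = 0.
  Uniform continuity up to e = 0 gives a fixed e > 0 whose \<open>H e\<close> still covers a ball
  around \<mu>, and its values are normal forms of mutually arc related tuples.\<close>

lemma arc_related_near:
  assumes h: "h \<in> G" "h NP = NP" "h (stereoN_inv 0) = stereoN_inv 0"
    and der: "(rep h has_derivative (\<lambda>z. a * z + b * cnj z)) (at 0)" and ab: "b \<noteq> 0" "cmod b < cmod a"
    and \<mu>: "\<mu> \<noteq> 0" "\<mu> \<noteq> 1"
  obtains \<delta> where "\<delta> > 0" "\<And>w. w \<in> ball \<mu> \<delta> \<Longrightarrow> arc_related G (normal_tuple \<mu>) (normal_tuple w)"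
proof -
  define \<phi> where "\<phi> = rep h"
  define A where "A = (\<lambda>z. a * z + b * cnj z)"
  have hz: "h (stereoN_inv z) = stereoN_inv (\<phi> z)" for z
    using rep_works[OF h(1,2)] by (simp add: \<phi>_def)
  have \<phi>0: "\<phi> 0 = 0" using h by (simp add: \<phi>_def rep_def)
  have \<phi>_eq: "\<phi> z = \<phi> w \<longleftrightarrow> z = w" for z w
    using rep_eq_iff[OF h(1,2)] by (simp add: \<phi>_def)
  have \<phi>_cont: "isCont \<phi> z" for z
    unfolding \<phi>_def
    by (rule rep_has_derivative[OF h(1,2), of z]) (rule has_derivative_continuous)
  have \<phi>_der: "(\<phi> has_derivative A) (at 0)" using der by (simp add: \<phi>_def A_def)
  obtain \<Phi> where \<Phi>: "continuous_on UNIV (\<lambda>(e, z). \<Phi> e z)" "\<And>z. \<Phi> 0 z = A z"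
    "\<And>e z. e > 0 \<Longrightarrow> \<Phi> e z = \<phi> (of_real e * z) / of_real e"
  proof (rule blowup_continuous_extension[OF \<phi>_cont \<phi>0 \<phi>_der])
    fix \<Phi> :: "real \<Rightarrow> complex \<Rightarrow> complex"
    assume "continuous_on UNIV (\<lambda>(e, z). \<Phi> e z)" "\<And>z. \<Phi> 0 z = A z"
      "\<And>e z. e > 0 \<Longrightarrow> \<Phi> e z = \<phi> (of_real e * z) / of_real e"
    then show thesis by (rule that)
  qed
  \<comment> \<open>Injectivity at e = 0 as well keeps the denominators of \<open>H\<close> nonzero
    on the whole compact parameter set.\<close>
  have \<Phi>_eq: "\<Phi> e z = \<Phi> e w \<longleftrightarrow> z = w" if "e \<ge> 0" for e z w
  proof (cases "e = 0")
    case True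
    show ?thesis unfolding True \<Phi>(2) A_def using stretch_inj[OF ab(2), of z w] by auto
  next
    case False
    then have "e > 0" using that by simp
    then show ?thesis by (simp add: \<Phi>(3) \<phi>_eq)
  qed
  have a: "a \<noteq> 0" using ab by auto
  obtain y D where y: "inj_on y {..<4}" "cross_ratio y = \<mu>" "D \<noteq> 0"
    "((\<lambda>k. cross_ratio (\<lambda>j. y j + k * cnj (y j))) has_field_derivative D) (at 0)"
    using exists_stretchable_tuple[OF \<mu>] by blast
  obtain r c d M where r: "r > 0" and cont_cd: "continuous_on (cball 0 r) c" "continuous_on (cball 0 r) d"
    and nz: "\<And>k. k \<in> cball 0 r \<Longrightarrow> c k \<noteq> 0 \<and> d k \<noteq> 0 \<and> M k \<noteq> 0"
    and factor: "\<And>k y. k \<in> cball 0 r \<Longrightarrow> A (c k * A (d k * (y - b / a * cnj y))) = M k * (y + k * cnj y)"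
  proof (rule beltrami_factorization[OF ab A_def])
    fix r c d M
    assume "r > 0" "continuous_on (cball 0 r) c" "continuous_on (cball 0 r) d"
      "\<And>k. k \<in> cball 0 r \<Longrightarrow> c k \<noteq> 0 \<and> d k \<noteq> 0 \<and> M k \<noteq> 0"
      "\<And>k y. k \<in> cball 0 r \<Longrightarrow> A (c k * A (d k * (y - b / a * cnj y))) = M k * (y + k * cnj y)"
    then show thesis by (rule that)
  qed
  \<comment> \<open>The shifted tuple for which \<open>factor\<close> yields multiples of y + k cnj
    y.\<close>
  define x where "x j = y j - b / a * cnj (y j)" for j
  have x: "inj_on x {..<4}"
  proof -
    have "x i = x j \<longleftrightarrow> y i = y j" for i j
    proof
      assume "x i = x j"
      then have "a * x i = a * x j" by simp
      then have "a * y i + (- b) * cnj (y i) = a * y j + (- b) * cnj (y j)"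
        using a by (simp add: x_def algebra_simps)
      then show "y i = y j" using stretch_inj[of "- b" a "y i" "y j"] ab by simp
    qed (simp add: x_def)
    then show ?thesis using y(1) by (simp add: inj_on_4)
  qed
  define X where "X e k j = \<Phi> e (c k * \<Phi> e (d k * x j))" for e k j
  define H where "H e k = cross_ratio (X e k)" for e k
  have X_inj: "inj_on (X e k) {..<4}" if "e \<ge> 0" "k \<in> cball 0 r" for e k
    using x nz[OF that(2)] by (simp add: X_def inj_on_4 \<Phi>_eq[OF that(1)])
  have X_cont: "continuous_on ({0..1} \<times> cball 0 r) (\<lambda>p. X (fst p) (snd p) j)" for j
  proof -
    have \<Phi>': "continuous_on S (\<lambda>p. \<Phi> (f p) (g p))"
      if "continuous_on S f" "continuous_on S g" for S :: "(real \<times> complex) set" and f g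
      using continuous_on_compose2[OF \<Phi>(1) continuous_on_Pair[OF that]] by simp
    have cd: "continuous_on ({0..1::real} \<times> cball 0 r) (\<lambda>p. f (snd p))"
      if "continuous_on (cball 0 r) f" for f :: "complex \<Rightarrow> complex"
      by (rule continuous_on_compose2[OF that continuous_on_snd[OF continuous_on_id]]) auto
    show ?thesis unfolding X_def
      by (intro \<Phi>' continuous_on_mult cd[OF cont_cd(1)] cd[OF cont_cd(2)]
          continuous_on_const continuous_on_fst[OF continuous_on_id])
  qed
  have H_cont: "continuous_on ({0..1} \<times> cball 0 r) (\<lambda>p. H (fst p) (snd p))"
    unfolding H_def cross_ratio_def
  proof (intro continuous_on_divide continuous_on_mult continuous_on_diff X_cont ballI)
    fix p :: "real \<times> complex" assume "p \<in> {0..1} \<times> cball 0 r"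
    then have "inj_on (X (fst p) (snd p)) {..<4}" by (intro X_inj) auto
    then show "(X (fst p) (snd p) 3 - X (fst p) (snd p) 2) * (X (fst p) (snd p) 1 - X (fst p) (snd p) 0) \<noteq> 0"
      by (auto simp: inj_on_4)
  qed
  have H0: "H 0 k = cross_ratio (\<lambda>j. y j + k * cnj (y j))" if "k \<in> cball 0 r" for k
  proof -
    have "X 0 k = (\<lambda>j. M k * (y j + k * cnj (y j)))"
      unfolding X_def \<Phi>(2) x_def factor[OF that] ..
    then show ?thesis using nz[OF that] by (simp add: H_def cross_ratio_scale)
  qed
  \<comment> \<open>The error |D| r1 / 2 allowed by \<open>disc_image_covers_ball\<close> is split
    evenly between linearising \<open>H 0\<close> and passing from \<open>H 0\<close> to
    \<open>H e\<close>.\<close>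
  obtain r1 where r1: "0 < r1" "r1 \<le> r"
    and lin: "\<And>k. k \<in> cball 0 r1 \<Longrightarrow> cmod (H 0 k - (\<mu> + D * k)) \<le> cmod D / 4 * cmod k"
  proof -
    have "cmod D / 4 > 0" using \<open>D \<noteq> 0\<close> by simp
    from y(4)[unfolded has_field_derivative_def has_derivative_at_alt, THEN conjunct2, rule_format, OF this]
    obtain s where s: "s > 0" "\<And>k. cmod k < s \<Longrightarrow>
       cmod (cross_ratio (\<lambda>j. y j + k * cnj (y j)) - \<mu> - D * k) \<le> cmod D / 4 * cmod k"
      using y(2) by auto
    show thesis
    proof (rule that[of "min r (s / 2)"])
      fix k assume k: "k \<in> cball (0::complex) (min r (s / 2))"
      then have "k \<in> cball 0 r" "cmod k < s" using s(1) by auto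
      then show "cmod (H 0 k - (\<mu> + D * k)) \<le> cmod D / 4 * cmod k"
        using s(2)[of k] H0[of k] by (simp add: diff_diff_eq)
    qed (use r s in auto)
  qed
  have "uniformly_continuous_on ({0..1} \<times> cball 0 r) (\<lambda>p. H (fst p) (snd p))"
    by (intro compact_uniformly_continuous H_cont compact_Times compact_Icc compact_cball)
  moreover have "cmod D * r1 / 4 > 0" using \<open>D \<noteq> 0\<close> r1 by simp
  ultimately obtain s where s: "s > 0" "\<And>p p'. p \<in> {0..1} \<times> cball 0 r \<Longrightarrow> p' \<in> {0..1} \<times> cball 0 r \<Longrightarrow>
     dist p' p < s \<Longrightarrow> dist (H (fst p') (snd p')) (H (fst p) (snd p)) < cmod D * r1 / 4"
    unfolding uniformly_continuous_on_def by metis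
  define e where "e = min 1 (s / 2)"
  have e: "0 < e" "e \<le> 1" "e < s" using s(1) by (auto simp: e_def)
  have near: "cmod (H e k - (\<mu> + D * k)) \<le> cmod D * r1 / 2" if k: "k \<in> cball 0 r1" for k
  proof -
    have "dist (H e k) (H 0 k) < cmod D * r1 / 4"
      using s(2)[of "(0, k)" "(e, k)"] e k r1 by (simp add: dist_Pair_Pair dist_real_def)
    moreover have "cmod D / 4 * cmod k \<le> cmod D / 4 * r1"
      using k by (intro mult_left_mono) auto
    ultimately show ?thesis
      using lin[OF k] dist_triangle[of "H e k" "\<mu> + D * k" "H 0 k"]
      by (simp add: dist_norm)
  qed
  have cont_He: "continuous_on (cball 0 r1) (H e)"
  proof -
    have "continuous_on (cball 0 r1) (\<lambda>k. H (fst (e, k)) (snd (e, k)))"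
      by (rule continuous_on_compose2[OF H_cont]) (use e r1 in \<open>auto intro!: continuous_intros\<close>)
    then show ?thesis by simp
  qed
  \<comment> \<open>Only the inner dilation carries the factor e: the outer rescaling by e
    multiplies all four points alike and leaves the cross ratio unchanged.\<close>
  define W where "W k i = h (dilat (Ln (c k)) (h (dilat (Ln (of_real e * d k)) (stereoN_inv (x i)))))" for k i
  have W: "arc_related G (W k) (normal_tuple (H e k))" if "k \<in> cball 0 r" for k
  proof -
    have eX: "of_real e * X e k i = \<phi> (c k * \<phi> (of_real e * d k * x i))" for i
      using e by (simp add: X_def \<Phi>(3) mult.assoc)
    then have W_eq: "W k = (\<lambda>i. stereoN_inv (of_real e * X e k i))"
      using nz[OF that] e by (auto simp: W_def hz)
    have "inj_on (\<lambda>i. of_real e * X e k i) {..<4}"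
      using X_inj[OF _ that, of e] e by (simp add: inj_on_4)
    from arc_related_normal_tuple_finite[OF this] show ?thesis
      unfolding W_eq H_def using cross_ratio_scale[of "of_real e"] e by simp
  qed
  have WW: "arc_related G (W k) (W k')" for k k'
    unfolding W_def by (rule arc_related_dilat_word[OF h(1)])
  define \<delta> where "\<delta> = cmod D * r1 / 2"
  have \<delta>: "\<delta> > 0" using \<open>D \<noteq> 0\<close> r1 by (simp add: \<delta>_def)
  have hit: "\<exists>k\<in>cball 0 r. H e k = w" if "w \<in> ball \<mu> \<delta>" for w
  proof -
    have "w \<in> cball \<mu> (cmod D * r1 / 2)" using that by (simp add: \<delta>_def)
    then obtain k where "k \<in> cball 0 r1" "H e k = w"
      using disc_image_covers_ball[OF cont_He r1(1) \<open>D \<noteq> 0\<close> near] by blast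
    then show ?thesis using r1(2) by auto
  qed
  have "arc_related G (normal_tuple \<mu>) (normal_tuple w)" if w: "w \<in> ball \<mu> \<delta>" for w
  proof -
    \<comment> \<open>For positive e the value \<mu> need not be taken at k = 0, so it is hit
      separately; the word tuples then link \<mu> to w.\<close>
    obtain k k' where k: "k \<in> cball 0 r" "H e k = \<mu>" "k' \<in> cball 0 r" "H e k' = w"
      using hit[OF w] hit[of \<mu>] \<delta> by auto
    show ?thesis
      using arc_related_trans[OF arc_related_sym[OF W[OF k(1)]] arc_related_trans[OF WW W[OF k(3)]]]
      unfolding k(2,4) .
  qed
  then show thesis using that \<delta> by blast
qed

lemma arc_related_distinct_tuples:
  assumes f: "f \<in> G" "f \<notin> Mob"
    and p: "\<forall>i<4. p i \<in> S2" "inj_on p {..<4}" and q: "\<forall>i<4. q i \<in> S2" "inj_on q {..<4}"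
  shows "arc_related G p q"
proof -
  obtain h a b where h: "h \<in> G" "h NP = NP" "h (stereoN_inv 0) = stereoN_inv 0"
    "(rep h has_derivative (\<lambda>z. a * z + b * cnj z)) (at 0)" "b \<noteq> 0" "cmod b < cmod a"
    using exists_nonconformal[OF f] by blast
  obtain \<mu> where \<mu>: "\<mu> \<noteq> 0" "\<mu> \<noteq> 1" "arc_related G p (normal_tuple \<mu>)"
    using arc_related_normal_tuple[OF p] by blast
  obtain \<nu> where \<nu>: "\<nu> \<noteq> 0" "\<nu> \<noteq> 1" "arc_related G q (normal_tuple \<nu>)"
    using arc_related_normal_tuple[OF q] by blast
  have conn: "connected (- {0, 1 :: complex})"
    by (intro path_connected_imp_connected path_connected_complement_countable) auto
  have "arc_related G (normal_tuple \<mu>) (normal_tuple \<nu>)"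
  \<comment> \<open>Every class is relatively open in the twice punctured plane, which is connected,
    so there is only one.\<close>
  proof (rule connected_equivalence_relation[OF conn, of \<mu> \<nu> "\<lambda>u v. arc_related G (normal_tuple u) (normal_tuple v)"])
    fix u :: complex assume u: "u \<in> - {0, 1}"
    then obtain \<delta> where \<delta>: "\<delta> > 0" "\<And>w. w \<in> ball u \<delta> \<Longrightarrow> arc_related G (normal_tuple u) (normal_tuple w)"
      using arc_related_near[OF h, of u] by auto
    show "\<exists>T. openin (top_of_set (- {0, 1})) T \<and> u \<in> T \<and>
      (\<forall>x\<in>T. arc_related G (normal_tuple u) (normal_tuple x))"
      using u \<delta> by (intro exI[of _ "- {0, 1} \<inter> ball u \<delta>"]) (auto intro: openin_open_Int)
  qed (use \<mu> \<nu> in \<open>auto intro: arc_related_sym elim: arc_related_trans\<close>)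
  then show ?thesis
    by (rule arc_related_trans[OF \<mu>(3) arc_related_trans[OF _ arc_related_sym[OF \<nu>(3)]]])
qed

end

theorem theoremA:
  fixes G :: "(real^3 \<Rightarrow> real^3) set"
  assumes "group_of_maps G" and "G \<subseteq> Diff1_plus" and "Mob \<subset> G"
  shows "\<forall>p q :: nat \<Rightarrow> real^3.
           (\<forall>i<4. p i \<in> S2) \<and> inj_on p {..<4} \<and> (\<forall>i<4. q i \<in> S2) \<and> inj_on q {..<4} \<longrightarrow>
           (\<exists>g :: real \<Rightarrow> real^3 \<Rightarrow> real^3.
               (\<forall>t\<in>{0..1}. g t \<in> G) \<and> g 0 = id \<and> uniform_continuous_path g \<and>
               (\<forall>i<4. g 1 (p i) = q i))
           \<and> (\<exists>h\<in>G. \<forall>i<4. h (p i) = q i)"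
proof (intro allI impI, elim conjE)
  fix p q :: "nat \<Rightarrow> real^3"
  assume *: "\<forall>i<4. p i \<in> S2" "inj_on p {..<4}" "\<forall>i<4. q i \<in> S2" "inj_on q {..<4}"
  interpret Mob_overgroup G using assms by unfold_locales auto
  obtain f where "f \<in> G" "f \<notin> Mob" using assms(3) by blast
  from arc_related_distinct_tuples[OF this *] obtain \<gamma> where
    \<gamma>: "arc_in G \<gamma>" "\<gamma> 0 = id" "\<forall>i<4. \<gamma> 1 (p i) = q i"
    unfolding arc_related_def by blast
  have "uniform_continuous_path \<gamma>"
    using \<gamma>(1) by (intro uniform_continuous_pathI) (simp add: arc_in_def)
  moreover have "\<forall>t\<in>{0..1}. \<gamma> t \<in> G" using \<gamma>(1) by (simp add: arc_in_def)
  moreover from this have "\<gamma> 1 \<in> G" by simp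
  ultimately show "(\<exists>g :: real \<Rightarrow> real^3 \<Rightarrow> real^3.
               (\<forall>t\<in>{0..1}. g t \<in> G) \<and> g 0 = id \<and> uniform_continuous_path g \<and>
               (\<forall>i<4. g 1 (p i) = q i))
           \<and> (\<exists>h\<in>G. \<forall>i<4. h (p i) = q i)"
    using \<gamma>(2,3) by blast
qed

end
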